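(* Let $\Phi$ be a field of characteristic zero. For any real number $\alpha>1$ there exists an algebra $C_\alpha$ with involution $*$ over $\Phi$ such that $$\underline{{\rm exp}}^*(C_\alpha)=1\quad\text{and}\quad \overline{{\rm exp}}^*(C_\alpha)=\alpha .$$
   Context: All algebras are over a field $\Phi$ of characteristic zero, are not assumed associative or unital, and may be infinite-dimensional. An involution on $A$ is a $\Phi$-linear map $*\colon A\to A$ with $(a^* )^*=a$ and $(ab)^*=b^*a^*$. Put $A^+=\{a\in A: a^*=a\}$ and $A^-=\{b\in A: b^*=-b\}$. Let $\Phi\{X,Y\}$ be the free nonassociative algebra over $\Phi$ on the free generators $X\cup Y$, $X=\{x_1,x_2,\ldots\}$, $Y=\{y_1,y_2,\ldots\}$. A polynomial $f(x_1,\ldots,x_m,y_1,\ldots,y_r)\in\Phi\{X,Y\}$ is a $*$-identity of $A$ if $f(a_1,\ldots,a_m,b_1,\ldots,b_r)=0$ for all $a_1,\ldots,a_m\in A^+$ and $b_1,\ldots,b_r\in A^-$. Let $Id^*(A)$ be the set of all $*$-identities of $A$. For $0\le k\le n$ let $P^*_{k,n-k}$ be the space of all multilinear polynomials in $x_1,\ldots,x_k,y_1,\ldots,y_{n-k}$. Define $$c^*_{k,n-k}(A)=\dim\frac{P^*_{k,n-k}}{P^*_{k,n-k}\cap Id^*(A)},\qquad c^*_n(A)=\sum_{k=0}^n\binom nk c^*_{k,n-k}(A),$$ $$\underline{{\rm exp}}^*(A)=\liminf_{n\to\infty}\sqrt[n]{c^*_n(A)},\qquad \overline{{\rm exp}}^*(A)=\limsup_{n\to\infty}\sqrt[n]{c^*_n(A)}.$$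 *)

theory Defs
  imports
    "HOL-Library.Poly_Mapping"
    "HOL-Library.Multiset"
    "HOL-Library.Extended_Real"
    "HOL-Library.Liminf_Limsup"
    "Jordan_Normal_Form.VS_Connect"
begin

locale algebra_with_involution = vector_space scale
  for scale :: "'k::field_char_0 \<Rightarrow> 'a::ab_group_add \<Rightarrow> 'a" +
  fixes mul :: "'a \<Rightarrow> 'a \<Rightarrow> 'a"
    and star :: "'a \<Rightarrow> 'a"
  assumes linear_mult_left: "Vector_Spaces.linear scale scale (\<lambda>a. mul a b)"
    and linear_mult_right: "Vector_Spaces.linear scale scale (\<lambda>b. mul a b)"
    and linear_star: "Vector_Spaces.linear scale scale star"
    and star_star: "star (star a) = a"
    and star_mult: "star (mul a b) = mul (star b) (star a)"

definition symmetric_elements :: "('a \<Rightarrow> 'a) \<Rightarrow> 'a set"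
  where "symmetric_elements star = {a. star a = a}"

definition skew_elements :: "('a::uminus \<Rightarrow> 'a) \<Rightarrow> 'a set"
  where "skew_elements star = {b. star b = - b}"

text \<open>
  The generators are indexed from \<open>0\<close>: \<open>Sym i\<close> and \<open>Skew i\<close> stand for
  \<open>x\<^sub>i\<^sub>+\<^sub>1\<close> and \<open>y\<^sub>i\<^sub>+\<^sub>1\<close>.
\<close>

datatype generator = Sym nat | Skew nat

text \<open>
  The nonassociative words in the generators (no empty word) form the free magma; the free
  nonassociative algebra is the vector space with basis this magma, that is, the finitely
  supported functions from words to the field.
\<close>

datatype magma_word = Gen generator | Juxt magma_word magma_word

type_synonym 'k free_algebra = "magma_word \<Rightarrow>\<^sub>0 'k"

definition free_scale :: "'k::field \<Rightarrow> 'k free_algebra \<Rightarrow> 'k free_algebra"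
  where "free_scale c f = Poly_Mapping.map ((*) c) f"

primrec generators :: "magma_word \<Rightarrow> generator multiset"
  where
    "generators (Gen g) = {#g#}"
  | "generators (Juxt u v) = generators u + generators v"

primrec eval_word :: "('a \<Rightarrow> 'a \<Rightarrow> 'a) \<Rightarrow> (generator \<Rightarrow> 'a) \<Rightarrow> magma_word \<Rightarrow> 'a"
  where
    "eval_word mul \<phi> (Gen g) = \<phi> g"
  | "eval_word mul \<phi> (Juxt u v) = mul (eval_word mul \<phi> u) (eval_word mul \<phi> v)"

text \<open>
  The value of a polynomial under the substitution \<open>\<phi>\<close>: the linear extension of
  \<^const>\<open>eval_word\<close>, i.e. the algebra homomorphism extending \<open>\<phi>\<close>.
\<close>

definition eval_poly ::
    "('k::field \<Rightarrow> 'a::ab_group_add \<Rightarrow> 'a) \<Rightarrow> ('a \<Rightarrow> 'a \<Rightarrow> 'a) \<Rightarrow> (generator \<Rightarrow> 'a)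
      \<Rightarrow> 'k free_algebra \<Rightarrow> 'a"
  where "eval_poly scale mul \<phi> f =
    (\<Sum>w\<in>Poly_Mapping.keys f. scale (Poly_Mapping.lookup f w) (eval_word mul \<phi> w))"

text \<open>
  A substitution assigns a value to every generator; only those occurring in the polynomial
  matter.
\<close>

definition star_identities ::
    "('k::field \<Rightarrow> 'a::ab_group_add \<Rightarrow> 'a) \<Rightarrow> ('a \<Rightarrow> 'a \<Rightarrow> 'a) \<Rightarrow> ('a \<Rightarrow> 'a)
      \<Rightarrow> 'k free_algebra set"
  where "star_identities scale mul star =
    {f. \<forall>\<phi>. (\<forall>i. \<phi> (Sym i) \<in> symmetric_elements star) \<and> (\<forall>i. \<phi> (Skew i) \<in> skew_elements star)
          \<longrightarrow> eval_poly scale mul \<phi> f = 0}"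

definition multilinear_polys :: "nat \<Rightarrow> nat \<Rightarrow> 'k::field free_algebra set"
  where "multilinear_polys k l =
    {f. \<forall>w\<in>Poly_Mapping.keys f. generators w = mset_set (Sym ` {..<k} \<union> Skew ` {..<l})}"

text \<open>
  The quotient \<open>V / W\<close> on cosets, as a \<^type>\<open>module\<close> record so that \<^const>\<open>vectorspace.dim\<close>
  applies to it. The fields \<open>mult\<close> and \<open>one\<close> play no role. In \<^const>\<open>smult\<close> the
  summand \<open>w\<close> makes \<open>0 \<cdot> P\<close> the zero coset \<open>W\<close> rather than \<open>{0}\<close>.
\<close>

definition quotient_space ::
    "('k \<Rightarrow> 'v \<Rightarrow> 'v) \<Rightarrow> 'v::ab_group_add set \<Rightarrow> 'v set \<Rightarrow> ('k, 'v set) module"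
  where "quotient_space scale V W =
    \<lparr> carrier = (\<lambda>v. (+) v ` W) ` V,
      mult = undefined,
      one = undefined,
      zero = W,
      add = (\<lambda>P Q. {p + q | p q. p \<in> P \<and> q \<in> Q}),
      smult = (\<lambda>c P. {scale c p + w | p w. p \<in> P \<and> w \<in> W}) \<rparr>"

lemma vectorspace_quotient_space:
  fixes scale :: "'k::field \<Rightarrow> 'v::ab_group_add \<Rightarrow> 'v"
  assumes "vector_space scale" and V: "module.subspace scale V" and W: "module.subspace scale W"
  shows "vectorspace class_ring (quotient_space scale V W)"
proof -
  interpret vector_space scale by fact
  let ?Q = "quotient_space scale V W"
  define C where "C v = (+) v ` W" for v
  have add: "C u \<oplus>\<^bsub>?Q\<^esub> C v = C (u + v)" for u v
  proof (intro equalityI subsetI)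
    fix x assume "x \<in> C u \<oplus>\<^bsub>?Q\<^esub> C v"
    then obtain a b where "a \<in> W" "b \<in> W" "x = u + a + (v + b)"
      by (auto simp: quotient_space_def C_def)
    then show "x \<in> C (u + v)"
      using subspace_add[OF W] unfolding C_def
      by (intro image_eqI[of _ _ "a + b"]) (auto simp: algebra_simps)
  next
    fix x assume "x \<in> C (u + v)"
    then obtain w where w: "w \<in> W" "x = (u + 0) + (v + w)"
      by (auto simp: C_def algebra_simps)
    have "u + 0 \<in> C u" "v + w \<in> C v"
      using subspace_0[OF W] w(1) unfolding C_def by (blast intro: imageI)+
    then show "x \<in> C u \<oplus>\<^bsub>?Q\<^esub> C v"
      unfolding w(2) quotient_space_def partial_object.simps ring.simps by auto
  qed
  have smult: "c \<odot>\<^bsub>?Q\<^esub> C v = C (scale c v)" for c v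
  proof (intro equalityI subsetI)
    fix x assume "x \<in> c \<odot>\<^bsub>?Q\<^esub> C v"
    then obtain a b where "a \<in> W" "b \<in> W" "x = scale c (v + a) + b"
      by (auto simp: quotient_space_def C_def)
    then show "x \<in> C (scale c v)"
      using subspace_add[OF W] subspace_scale[OF W] unfolding C_def
      by (intro image_eqI[of _ _ "scale c a + b"]) (auto simp: scale_right_distrib algebra_simps)
  next
    fix x assume "x \<in> C (scale c v)"
    then obtain w where w: "w \<in> W" "x = scale c (v + 0) + w"
      by (auto simp: C_def)
    have "v + 0 \<in> C v"
      using subspace_0[OF W] unfolding C_def by (blast intro: imageI)
    then show "x \<in> c \<odot>\<^bsub>?Q\<^esub> C v"
      unfolding w(2) quotient_space_def using w(1) by auto
  qed
  have zero: "\<zero>\<^bsub>?Q\<^esub> = C 0" by (simp add: quotient_space_def C_def)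
  have carrier: "carrier ?Q = C ` V" by (simp add: quotient_space_def C_def)
  have "abelian_group ?Q"
  proof (rule abelian_groupI)
    fix P assume "P \<in> carrier ?Q"
    then obtain v where "v \<in> V" "P = C v" by (auto simp: carrier)
    then show "\<exists>P'\<in>carrier ?Q. P' \<oplus>\<^bsub>?Q\<^esub> P = \<zero>\<^bsub>?Q\<^esub>"
      using subspace_neg[OF V, of v] add[of "- v" v]
      by (auto simp: carrier zero)
  qed (auto simp: carrier add zero algebra_simps subspace_0[OF V] subspace_add[OF V])
  moreover have "cring (class_ring :: 'k ring)"
    using class_field by (auto simp: field_def domain_def)
  ultimately have "Module.module class_ring ?Q"
    by (intro moduleI)
      (auto simp: carrier add smult scale_left_distrib scale_right_distrib
        subspace_add[OF V] subspace_scale[OF V])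
  then show ?thesis
    by (simp add: vectorspace_def class_field)
qed

definition star_codim ::
    "('k::field \<Rightarrow> 'a::ab_group_add \<Rightarrow> 'a) \<Rightarrow> ('a \<Rightarrow> 'a \<Rightarrow> 'a) \<Rightarrow> ('a \<Rightarrow> 'a)
      \<Rightarrow> nat \<Rightarrow> nat \<Rightarrow> nat"
  where "star_codim scale mul star k l =
    vectorspace.dim (class_ring :: 'k ring)
      (quotient_space free_scale (multilinear_polys k l)
        (multilinear_polys k l \<inter> star_identities scale mul star))"

definition total_star_codim ::
    "('k::field \<Rightarrow> 'a::ab_group_add \<Rightarrow> 'a) \<Rightarrow> ('a \<Rightarrow> 'a \<Rightarrow> 'a) \<Rightarrow> ('a \<Rightarrow> 'a) \<Rightarrow> nat \<Rightarrow> nat"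
  where "total_star_codim scale mul star n =
    (\<Sum>k\<le>n. (n choose k) * star_codim scale mul star k (n - k))"

definition lower_star_exp ::
    "('k::field \<Rightarrow> 'a::ab_group_add \<Rightarrow> 'a) \<Rightarrow> ('a \<Rightarrow> 'a \<Rightarrow> 'a) \<Rightarrow> ('a \<Rightarrow> 'a) \<Rightarrow> ereal"
  where "lower_star_exp scale mul star =
    liminf (\<lambda>n. ereal (root n (real (total_star_codim scale mul star n))))"

definition upper_star_exp ::
    "('k::field \<Rightarrow> 'a::ab_group_add \<Rightarrow> 'a) \<Rightarrow> ('a \<Rightarrow> 'a \<Rightarrow> 'a) \<Rightarrow> ('a \<Rightarrow> 'a) \<Rightarrow> ereal"
  where "upper_star_exp scale mul star =
    limsup (\<lambda>n. ereal (root n (real (total_star_codim scale mul star n))))"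

end

theory Submission
  imports Defs
begin

text \<open>
  In a commutative algebra with the identity involution all elements are symmetric and only \<open>0\<close> is
  skew, so \<open>c\<^sup>*\<^sub>n\<close> is the ordinary codimension. Take a commutative algebra spanned by letters
  \<open>e\<^sub>a\<close> and states \<open>z\<^sub>k\<^sub>,\<^sub>t\<close> whose only nonzero products are \<open>z\<^sub>k\<^sub>,\<^sub>t e\<^sub>a = z\<^sub>k\<^sub>,\<^sub>t\<^sub>+\<^sub>1\<close>, where \<open>a = 0\<close> unless
  \<open>m\<^sub>k\<close> divides \<open>t\<close>, in which case \<open>a\<close> is a letter specific to \<open>t\<close>, and where track \<open>k\<close> ends at
  time \<open>L\<^sub>k = \<lfloor>\<alpha> ^ m\<^sub>k\<rfloor>\<close>. A multilinear polynomial of degree \<open>n\<close> is tested by choosing the variable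
  that is a state and the variables placed at the times divisible by \<open>m\<^sub>k\<close>. On one track the
  codimension is therefore, up to polynomial factors, the number of injections of the distinguished
  positions into the variables. It is at most about \<open>n\<^sup>n\<^sup>/\<^sup>m\<close> with \<open>n \<le> \<alpha>\<^sup>m\<close>, which is attained at
  \<open>n = L\<^sub>k\<close>. If \<open>m\<^sub>k\<^sub>+\<^sub>1\<close> exceeds \<open>L\<^sub>k\<close>, then in degree \<open>L\<^sub>k + 1\<close> at most one position is distinguished
  and the codimension is polynomial.
\<close>

section \<open>Dimension of a quotient space\<close>

locale quotient_by_subspace = vector_space scale
  for scale :: "'k::field \<Rightarrow> 'v::ab_group_add \<Rightarrow> 'v" +
  fixes V W :: "'v set"
  assumes subspace_V: "subspace V" and subspace_W: "subspace W"
begin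

abbreviation Q where "Q \<equiv> quotient_space scale V W"

definition coset where "coset v = (+) v ` W"

sublocale Q: vectorspace class_ring Q
  using vectorspace_quotient_space[OF vector_space_axioms subspace_V subspace_W] .

lemma carrier_Q: "carrier Q = coset ` V"
  by (simp add: quotient_space_def coset_def)

lemma zero_Q: "\<zero>\<^bsub>Q\<^esub> = W"
  by (simp add: quotient_space_def)

lemma mem_coset: "x \<in> coset v \<longleftrightarrow> x - v \<in> W"
  unfolding coset_def image_iff by (metis add_diff_cancel_left' diff_add_cancel add.commute)

lemma coset_eq_iff: "coset u = coset v \<longleftrightarrow> u - v \<in> W"
proof
  assume "coset u = coset v"
  then show "u - v \<in> W"
    using mem_coset[of u u] mem_coset[of u v] subspace_0[OF subspace_W] by simp
next
  assume uv: "u - v \<in> W"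
  have "x - u \<in> W \<longleftrightarrow> x - v \<in> W" for x
    using subspace_add[OF subspace_W _ uv, of "x - u"] subspace_diff[OF subspace_W _ uv, of "x - v"]
    by (auto simp: algebra_simps)
  then show "coset u = coset v"
    by (auto simp: mem_coset)
qed

lemma coset_add: "coset u \<oplus>\<^bsub>Q\<^esub> coset v = coset (u + v)"
proof (intro equalityI subsetI)
  fix x assume "x \<in> coset u \<oplus>\<^bsub>Q\<^esub> coset v"
  then obtain p q where "p - u \<in> W" "q - v \<in> W" "x = p + q"
    by (auto simp: quotient_space_def mem_coset)
  then show "x \<in> coset (u + v)"
    using subspace_add[OF subspace_W, of "p - u" "q - v"] by (simp add: mem_coset algebra_simps)
next
  fix x assume "x \<in> coset (u + v)"
  then have "u \<in> coset u" "x - u \<in> coset v" "x = u + (x - u)"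
    using subspace_0[OF subspace_W] by (auto simp: mem_coset algebra_simps)
  then show "x \<in> coset u \<oplus>\<^bsub>Q\<^esub> coset v"
    unfolding quotient_space_def partial_object.simps ring.simps by blast
qed

lemma coset_smult: "c \<odot>\<^bsub>Q\<^esub> coset v = coset (scale c v)"
proof (intro equalityI subsetI)
  fix x assume "x \<in> c \<odot>\<^bsub>Q\<^esub> coset v"
  then obtain p w where "p - v \<in> W" "w \<in> W" "x = scale c p + w"
    by (auto simp: quotient_space_def mem_coset)
  then show "x \<in> coset (scale c v)"
    using subspace_add[OF subspace_W subspace_scale[OF subspace_W, of "p - v" c], of w]
    by (simp add: mem_coset algebra_simps scale_right_diff_distrib)
next
  fix x assume "x \<in> coset (scale c v)"
  then have "v \<in> coset v" "x - scale c v \<in> W" "x = scale c v + (x - scale c v)"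
    using subspace_0[OF subspace_W] by (auto simp: mem_coset algebra_simps)
  then show "x \<in> c \<odot>\<^bsub>Q\<^esub> coset v"
    unfolding quotient_space_def module.simps by blast
qed

text \<open>Cutting \<open>U\<close> down to the kernel of \<open>g\<close> loses at most one
  dimension, which the coset of a single \<open>p\<close> with \<open>g p \<noteq> 0\<close>
  restores. \<open>U\<close> varies while \<open>V\<close> stays fixed because the induction
  descends to this kernel inside the same quotient.\<close>

lemma exists_spanning_set:
  assumes "finite F" and "\<And>g. g \<in> F \<Longrightarrow> Vector_Spaces.linear scale (*) g"
    and "subspace U" "U \<subseteq> V" and "\<And>v. v \<in> U \<Longrightarrow> (\<And>g. g \<in> F \<Longrightarrow> g v = 0) \<Longrightarrow> v \<in> W"
  shows "\<exists>B. finite B \<and> card B \<le> card F \<and> B \<subseteq> carrier Q \<and> coset ` U \<subseteq> Q.span B"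
  using assms
proof (induction F arbitrary: U rule: finite_induct)
  case empty
  then have "coset v = \<zero>\<^bsub>Q\<^esub>" if "v \<in> U" for v
    using that coset_eq_iff[of v 0] by (simp add: zero_Q) (simp add: coset_def)
  moreover have "\<zero>\<^bsub>Q\<^esub> \<in> Q.span {}"
    using Q.span_is_submodule[of "{}"] by (auto simp: submodule_def)
  ultimately show ?case by (intro exI[of _ "{}"]) auto
next
  case (insert g F)
  interpret g: Vector_Spaces.linear scale "(*)" g using insert.prems by blast
  define U' where "U' = {v \<in> U. g v = 0}"
  have "subspace U'"
    using insert.prems(2) unfolding U'_def subspace_def by (auto simp: g.add g.scale)
  then obtain B where B: "finite B" "card B \<le> card F" "B \<subseteq> carrier Q" "coset ` U' \<subseteq> Q.span B"
    using insert.IH[of U'] insert.prems unfolding U'_def by fastforce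
  show ?case
  proof (cases "U' = U")
    case True
    then show ?thesis using B insert.hyps by (intro exI[of _ B]) auto
  next
    case False
    then obtain p where p: "p \<in> U" "g p \<noteq> 0" unfolding U'_def by auto
    let ?B = "insert (coset p) B"
    have sub: "?B \<subseteq> carrier Q" using p B insert.prems(3) by (auto simp: carrier_Q)
    have "coset v \<in> Q.span ?B" if v: "v \<in> U" for v
    proof -
      \<comment> \<open>This choice puts \<open>v - scale c p\<close> into the kernel of
        \<open>g\<close>, where the induction hypothesis applies.\<close>
      define c where "c = g v / g p"
      have "v - scale c p \<in> U'"
        using p v insert.prems(2) unfolding U'_def c_def
        by (auto intro: subspace_diff subspace_scale simp: g.diff g.scale)
      then have "coset (v - scale c p) \<in> Q.span ?B"
        using B(4) Q.span_is_monotone[of B ?B] by auto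
      moreover have "coset (scale c p) \<in> Q.span ?B"
        using Q.span_is_submodule[OF sub] Q.in_own_span[OF sub]
        unfolding coset_smult[symmetric] submodule_def by (simp add: class_ring_simps)
      ultimately have "coset (v - scale c p) \<oplus>\<^bsub>Q\<^esub> coset (scale c p) \<in> Q.span ?B"
        using Q.span_is_submodule[OF sub] by (simp add: submodule_def)
      then show ?thesis by (simp add: coset_add)
    qed
    moreover have "card ?B \<le> card (insert g F)"
      using B insert.hyps card_insert_le_m1[of "Suc (card F)" B] by simp
    ultimately show ?thesis using B(1) sub by (intro exI[of _ ?B]) auto
  qed
qed

lemma
  assumes "finite F" and "\<And>g. g \<in> F \<Longrightarrow> Vector_Spaces.linear scale (*) g"
    and "\<And>v. v \<in> V \<Longrightarrow> (\<And>g. g \<in> F \<Longrightarrow> g v = 0) \<Longrightarrow> v \<in> W"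
  shows fin_dim_quotient: "Q.fin_dim" and dim_quotient_le: "Q.dim \<le> card F"
proof -
  obtain B where B: "finite B" "card B \<le> card F" "B \<subseteq> carrier Q" "carrier Q \<subseteq> Q.span B"
    using exists_spanning_set[OF assms(1,2) subspace_V] assms(3) by (auto simp: carrier_Q)
  then have "Q.gen_set B" using Q.span_is_subset2[of B] by auto
  then show "Q.fin_dim" "Q.dim \<le> card F"
    using B Q.gen_ge_dim[of B] unfolding Q.fin_dim_def by auto
qed

lemma lincomb_cosets:
  assumes "finite S" "\<And>P. P \<in> S \<Longrightarrow> r P \<in> V" "\<And>P. P \<in> S \<Longrightarrow> coset (r P) = P"
  shows "Q.lincomb a S = coset (\<Sum>P\<in>S. scale (a P) (r P))"
  using assms
proof (induction S rule: finite_induct)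
  case empty
  then show ?case by (simp add: Q.lincomb_def zero_Q coset_def)
next
  case (insert P S)
  have "P' \<in> carrier Q" if "P' \<in> insert P S" for P'
    using insert.prems[OF that] by (metis carrier_Q imageI)
  then have "Q.lincomb a (S \<union> {P}) = a P \<odot>\<^bsub>Q\<^esub> P \<oplus>\<^bsub>Q\<^esub> Q.lincomb a S"
    using insert.hyps by (intro Q.lincomb_insert) (auto simp: class_ring_simps)
  also have "\<dots> = coset (scale (a P) (r P) + (\<Sum>P\<in>S. scale (a P) (r P)))"
    using insert.IH insert.prems coset_smult[of "a P" "r P"] by (simp add: coset_add)
  finally show ?case using insert.hyps by simp
qed

text \<open>Functionals vanishing on \<open>W\<close> descend to the quotient. Being dual to the
  vectors \<open>u i\<close>, each of them isolates one coefficient of a linear relation between the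
  cosets.\<close>

lemma dim_quotient_ge:
  assumes "Q.fin_dim" "finite I" and u: "\<And>i. i \<in> I \<Longrightarrow> u i \<in> V"
    and lin: "\<And>i. i \<in> I \<Longrightarrow> Vector_Spaces.linear scale (*) (G i)"
    and GW: "\<And>i v. i \<in> I \<Longrightarrow> v \<in> W \<Longrightarrow> G i v = 0"
    and Gu: "\<And>i j. i \<in> I \<Longrightarrow> j \<in> I \<Longrightarrow> G i (u j) = (if i = j then 1 else 0)"
  shows "card I \<le> Q.dim"
proof -
  have G_eq: "G i v = G i w" if "i \<in> I" "coset v = coset w" for i v w
  proof -
    interpret g: Vector_Spaces.linear scale "(*)" "G i" using lin that by blast
    show ?thesis using GW[of i "v - w"] that by (simp add: coset_eq_iff g.diff)
  qed
  have inj: "inj_on (\<lambda>i. coset (u i)) I"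
    using G_eq Gu by (intro inj_onI) (metis zero_neq_one)
  define S where "S = (\<lambda>i. coset (u i)) ` I"
  define r where "r P = u (inv_into I (\<lambda>i. coset (u i)) P)" for P
  have r: "r (coset (u i)) = u i" if "i \<in> I" for i
    using inv_into_f_f[OF inj that] by (simp add: r_def)
  have "Q.lin_indpt S"
  proof (rule Q.finite_lin_indpt2)
    show "finite S" "S \<subseteq> carrier Q"
      using assms by (auto simp: S_def carrier_Q)
    fix a assume "Q.lincomb a S = \<zero>\<^bsub>Q\<^esub>"
    moreover have "Q.lincomb a S = coset (\<Sum>P\<in>S. scale (a P) (r P))"
      using assms(2) u r by (intro lincomb_cosets) (auto simp: S_def)
    moreover have "(\<Sum>P\<in>S. scale (a P) (r P)) = (\<Sum>i\<in>I. scale (a (coset (u i))) (u i))"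
      unfolding S_def by (simp add: sum.reindex[OF inj] r)
    moreover have "coset 0 = W" by (simp add: coset_def)
    ultimately have *: "coset (\<Sum>i\<in>I. scale (a (coset (u i))) (u i)) = coset 0"
      by (simp add: zero_Q)
    show "\<forall>P\<in>S. a P = \<zero>\<^bsub>class_ring\<^esub>"
    proof (clarsimp simp: S_def class_ring_simps)
      fix i assume i: "i \<in> I"
      interpret g: Vector_Spaces.linear scale "(*)" "G i" using lin i by blast
      have "0 = (\<Sum>j\<in>I. a (coset (u j)) * G i (u j))"
        using G_eq[OF i *] by (simp add: g.sum g.scale g.zero)
      also have "\<dots> = (\<Sum>j\<in>I. if i = j then a (coset (u j)) else 0)"
        using i Gu by (intro sum.cong) auto
      finally show "a (coset (u i)) = 0" using i assms(2) by simp
    qed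
  qed
  then have "card S \<le> Q.dim"
    using assms u by (intro Q.li_le_dim) (auto simp: S_def carrier_Q)
  then show ?thesis by (simp add: S_def card_image[OF inj])
qed

end

section \<open>Commutative algebras given by partial multiplication of a basis\<close>

text \<open>The formula of \<open>free_scale\<close> for an arbitrary index type, so that the free
  algebra and the algebra to be constructed share one vector space structure.\<close>

definition fs_scale :: "'k::field \<Rightarrow> ('i \<Rightarrow>\<^sub>0 'k) \<Rightarrow> ('i \<Rightarrow>\<^sub>0 'k)"
  where "fs_scale c f = Poly_Mapping.map ((*) c) f"

lemma lookup_fs_scale [simp]: "Poly_Mapping.lookup (fs_scale c f) i = c * Poly_Mapping.lookup f i"
  by (simp add: fs_scale_def Poly_Mapping.map.rep_eq when_def)

lemma free_scale_eq: "free_scale = fs_scale"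
  by (simp add: fun_eq_iff free_scale_def fs_scale_def)

lemma vector_space_fs_scale: "vector_space (fs_scale :: 'k::field \<Rightarrow> ('i \<Rightarrow>\<^sub>0 'k) \<Rightarrow> _)"
  by unfold_locales (auto intro!: poly_mapping_eqI simp: lookup_add algebra_simps)

definition lext :: "('k \<Rightarrow> 'v \<Rightarrow> 'v) \<Rightarrow> ('i \<Rightarrow> 'v) \<Rightarrow> ('i \<Rightarrow>\<^sub>0 'k::field) \<Rightarrow> 'v::ab_group_add"
  where "lext scale F f = (\<Sum>i\<in>Poly_Mapping.keys f. scale (Poly_Mapping.lookup f i) (F i))"

lemma eval_poly_eq_lext: "eval_poly scale mul \<phi> = lext scale (eval_word mul \<phi>)"
  by (simp add: fun_eq_iff eval_poly_def lext_def)

context vector_space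
begin

lemma lext_superset:
  assumes "finite S" "Poly_Mapping.keys f \<subseteq> S"
  shows "lext scale F f = (\<Sum>i\<in>S. scale (Poly_Mapping.lookup f i) (F i))"
  unfolding lext_def using assms by (intro sum.mono_neutral_left) (auto simp: in_keys_iff)

lemma linear_lext: "Vector_Spaces.linear fs_scale scale (lext scale F)"
proof -
  interpret fs: vector_space "fs_scale :: 'a \<Rightarrow> ('i \<Rightarrow>\<^sub>0 'a) \<Rightarrow> _" by (rule vector_space_fs_scale)
  have add: "lext scale F (f + g) = lext scale F f + lext scale F g" for f g
  proof -
    let ?S = "Poly_Mapping.keys f \<union> Poly_Mapping.keys g"
    have "lext scale F h = (\<Sum>i\<in>?S. scale (Poly_Mapping.lookup h i) (F i))"
      if "h \<in> {f, g, f + g}" for h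
      using that keys_add[of f g] by (intro lext_superset) auto
    then show ?thesis
      by (simp add: lookup_add scale_left_distrib sum.distrib)
  qed
  have smult: "lext scale F (fs_scale c f) = scale c (lext scale F f)" for c f
  proof -
    have "Poly_Mapping.keys (fs_scale c f) \<subseteq> Poly_Mapping.keys f"
      by (auto simp: in_keys_iff)
    then have "lext scale F (fs_scale c f)
        = (\<Sum>i\<in>Poly_Mapping.keys f. scale (c * Poly_Mapping.lookup f i) (F i))"
      by (subst lext_superset[of "Poly_Mapping.keys f"]) auto
    then show ?thesis
      by (simp add: lext_def scale_sum_right)
  qed
  show ?thesis
    by unfold_locales (auto simp: add smult)
qed

lemma linear_zero_on_singles:
  assumes "Vector_Spaces.linear fs_scale scale T" "\<And>i. T (Poly_Mapping.single i 1) = 0"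
  shows "T f = 0"
proof -
  interpret T: Vector_Spaces.linear fs_scale scale T by fact
  interpret fs: vector_space "fs_scale :: 'a \<Rightarrow> ('b \<Rightarrow>\<^sub>0 'a) \<Rightarrow> _" by (rule vector_space_fs_scale)
  have "f = (\<Sum>i\<in>Poly_Mapping.keys f. fs_scale (Poly_Mapping.lookup f i) (Poly_Mapping.single i 1))"
    by (rule poly_mapping_eqI)
      (auto simp: lookup_sum lookup_single when_def in_keys_iff if_distrib cong: if_cong)
  then have "T f = T \<dots>" by simp
  also have "\<dots> = 0" by (simp add: T.sum T.scale assms(2))
  finally show ?thesis .
qed

end

section \<open>Multilinearity of evaluation\<close>

context algebra_with_involution
begin

lemma eval_word_cong:
  "(\<And>g. g \<in># generators w \<Longrightarrow> \<phi> g = \<psi> g) \<Longrightarrow> eval_word mul \<phi> w = eval_word mul \<psi> w"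
proof (induction w)
  case (Juxt u v)
  have "eval_word mul \<phi> u = eval_word mul \<psi> u" "eval_word mul \<phi> v = eval_word mul \<psi> v"
    using Juxt.prems by (auto intro!: Juxt.IH)
  then show ?case by simp
qed simp

text \<open>At every product a variable of multiplicity one lies in exactly one of the two factors.
  The other factor is constant, so bilinearity of the product carries the induction.\<close>

lemma linear_eval_word:
  "count (generators w) g = 1 \<Longrightarrow>
    Vector_Spaces.linear scale scale (\<lambda>a. eval_word mul (\<phi>(g := a)) w)"
proof (induction w)
  case (Gen h)
  then show ?case using linear_id by (simp add: id_def split: if_splits)
next
  case (Juxt u v)
  have const: "eval_word mul (\<phi>(g := a)) w = eval_word mul \<phi> w" if "count (generators w) g = 0" for a w
    using that by (intro eval_word_cong) (auto simp: count_eq_zero_iff)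
  from Juxt.prems consider "count (generators u) g = 1" "count (generators v) g = 0"
    | "count (generators u) g = 0" "count (generators v) g = 1"
    by fastforce
  then show ?case
  proof cases
    case 1
    then show ?thesis
      using Vector_Spaces.linear_compose[OF Juxt.IH(1) linear_mult_left[of "eval_word mul \<phi> v"]]
      by (simp add: const comp_def del: fun_upd_apply)
  next
    case 2
    then show ?thesis
      using Vector_Spaces.linear_compose[OF Juxt.IH(2) linear_mult_right[of "eval_word mul \<phi> u"]]
      by (simp add: const comp_def del: fun_upd_apply)
  qed
qed

lemma linear_eval_poly_variable:
  assumes "\<And>w. w \<in> Poly_Mapping.keys f \<Longrightarrow> count (generators w) g = 1"
  shows "Vector_Spaces.linear scale scale (\<lambda>a. eval_poly scale mul (\<phi>(g := a)) f)"
proof -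
  have pair: "vector_space_pair scale scale" by unfold_locales
  show ?thesis
    unfolding eval_poly_def using linear_eval_word[OF assms]
    by (intro vector_space_pair.linear_compose_sum[OF pair] ballI
        vector_space_pair.linear_compose_scale_right[OF pair])
qed

end

text \<open>Multilinearity frees the variables one at a time: \<open>S\<close> collects those whose
  values need not be basis vectors, and a linear map that vanishes on the basis is zero.\<close>

lemma eval_poly_zero_if_zero_on_basis:
  fixes mul :: "('i \<Rightarrow>\<^sub>0 'k::field_char_0) \<Rightarrow> ('i \<Rightarrow>\<^sub>0 'k) \<Rightarrow> ('i \<Rightarrow>\<^sub>0 'k)"
  assumes "algebra_with_involution fs_scale mul star"
    and "finite X" and f: "\<And>w. w \<in> Poly_Mapping.keys f \<Longrightarrow> generators w = mset_set X"
    and zero: "\<And>\<phi>. eval_poly fs_scale mul (\<lambda>g. Poly_Mapping.single (\<phi> g) 1) f = 0"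
  shows "eval_poly fs_scale mul \<psi> f = 0"
proof -
  interpret algebra_with_involution fs_scale mul star by fact
  have "eval_poly fs_scale mul \<psi> f = 0"
    if "S \<subseteq> X" "\<forall>g\<in>X - S. \<exists>i. \<psi> g = Poly_Mapping.single i 1" for S \<psi>
    using finite_subset[OF that(1) assms(2)] that
  proof (induction S arbitrary: \<psi> rule: finite_induct)
    case empty
    then have "\<forall>g\<in>X. \<exists>i. \<psi> g = Poly_Mapping.single i 1" by simp
    from bchoice[OF this] obtain \<phi> where \<phi>: "\<forall>g\<in>X. \<psi> g = Poly_Mapping.single (\<phi> g) 1"
      by blast
    have "eval_word mul \<psi> w = eval_word mul (\<lambda>g. Poly_Mapping.single (\<phi> g) 1) w"
      if "w \<in> Poly_Mapping.keys f" for w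
      using f[OF that] \<phi> assms(2) by (intro eval_word_cong) auto
    then show ?case
      using zero[of \<phi>] unfolding eval_poly_def by (simp cong: sum.cong)
  next
    case (insert g S)
    have "eval_poly fs_scale mul (\<psi>(g := a)) f = 0" for a
    proof (rule linear_zero_on_singles[where T = "\<lambda>a. eval_poly fs_scale mul (\<psi>(g := a)) f"])
      show "Vector_Spaces.linear fs_scale fs_scale (\<lambda>a. eval_poly fs_scale mul (\<psi>(g := a)) f)"
        using f insert.prems assms(2) by (intro linear_eval_poly_variable) auto
      show "eval_poly fs_scale mul (\<psi>(g := Poly_Mapping.single i 1)) f = 0" for i
        using insert.prems by (intro insert.IH) auto
    qed
    from this[of "\<psi> g"] show ?case by simp
  qed
  from this[of X \<psi>] show ?thesis by simp
qed

locale commutative_partial_magma =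
  fixes op :: "'i \<Rightarrow> 'i \<Rightarrow> 'i option"
  assumes op_commute: "op i j = op j i"
begin

definition basis_elem :: "'i option \<Rightarrow> 'i \<Rightarrow>\<^sub>0 'k::field_char_0"
  where "basis_elem r = (case r of None \<Rightarrow> 0 | Some i \<Rightarrow> Poly_Mapping.single i 1)"

definition mul :: "('i \<Rightarrow>\<^sub>0 'k::field_char_0) \<Rightarrow> ('i \<Rightarrow>\<^sub>0 'k) \<Rightarrow> ('i \<Rightarrow>\<^sub>0 'k)"
  where "mul x y = lext fs_scale (\<lambda>i. lext fs_scale (\<lambda>j. basis_elem (op i j)) y) x"

primrec ev :: "(generator \<Rightarrow> 'i) \<Rightarrow> magma_word \<Rightarrow> 'i option"
  where
    "ev \<phi> (Gen g) = Some (\<phi> g)"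
  | "ev \<phi> (Juxt u v) = Option.bind (ev \<phi> u) (\<lambda>i. Option.bind (ev \<phi> v) (op i))"

lemma mul_commute: "mul x y = mul y (x :: 'i \<Rightarrow>\<^sub>0 'k::field_char_0)"
proof -
  interpret fs: vector_space "fs_scale :: 'k \<Rightarrow> ('i \<Rightarrow>\<^sub>0 'k) \<Rightarrow> _" by (rule vector_space_fs_scale)
  have *: "mul x y = (\<Sum>i\<in>Poly_Mapping.keys x. \<Sum>j\<in>Poly_Mapping.keys y.
      fs_scale (Poly_Mapping.lookup x i) (fs_scale (Poly_Mapping.lookup y j) (basis_elem (op i j))))" for x y :: "'i \<Rightarrow>\<^sub>0 'k"
    by (simp add: mul_def lext_def fs.scale_sum_right)
  note *[of x y]
  also have "(\<Sum>i\<in>Poly_Mapping.keys x. \<Sum>j\<in>Poly_Mapping.keys y.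
      fs_scale (Poly_Mapping.lookup x i) (fs_scale (Poly_Mapping.lookup y j) (basis_elem (op i j)))) = mul y x"
    unfolding *[of y x] 
    by (subst sum.swap, intro sum.cong refl) (metis op_commute fs.scale_left_commute)
  finally show ?thesis .
qed

lemma algebra_with_involution_mul:
  "algebra_with_involution fs_scale (mul :: ('i \<Rightarrow>\<^sub>0 'k::field_char_0) \<Rightarrow> _) (\<lambda>a. a)"
proof -
  interpret fs: vector_space "fs_scale :: 'k \<Rightarrow> ('i \<Rightarrow>\<^sub>0 'k) \<Rightarrow> _" by (rule vector_space_fs_scale)
  have "Vector_Spaces.linear fs_scale fs_scale (\<lambda>a. mul a b)" for b :: "'i \<Rightarrow>\<^sub>0 'k"
    unfolding mul_def by (rule fs.linear_lext)
  moreover from this have "Vector_Spaces.linear fs_scale fs_scale (\<lambda>a. mul b a)" for b :: "'i \<Rightarrow>\<^sub>0 'k"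
    by (subst mul_commute)
  ultimately show ?thesis
    using fs.linear_id
    by (intro algebra_with_involution.intro algebra_with_involution_axioms.intro fs.vector_space_axioms)
      (simp_all add: id_def mul_commute)
qed

lemma eval_word_basis:
  "eval_word mul (\<lambda>g. Poly_Mapping.single (\<phi> g) 1) w = (basis_elem (ev \<phi> w) :: 'i \<Rightarrow>\<^sub>0 'k::field_char_0)"
proof (induction w)
  case (Gen g)
  then show ?case by (simp add: basis_elem_def)
next
  case (Juxt u v)
  interpret fs: vector_space "fs_scale :: 'k \<Rightarrow> ('i \<Rightarrow>\<^sub>0 'k) \<Rightarrow> _" by (rule vector_space_fs_scale)
  show ?case
    using Juxt by (auto simp: basis_elem_def mul_def split: option.split) (simp_all add: lext_def)
qed

section \<open>Codimension bounds from classes of words\<close>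

definition word_class :: "nat \<Rightarrow> (generator \<Rightarrow> 'i) \<Rightarrow> 'i \<Rightarrow> magma_word set"
  where "word_class n \<phi> r = {w. generators w = mset_set (Sym ` {..<n}) \<and> ev \<phi> w = Some r}"

text \<open>At a basis substitution, the coordinate of the value at \<open>r\<close> is the sum of
  the coefficients over one word class. Collecting the classes as sets identifies all pairs of
  \<open>\<phi>\<close> and \<open>r\<close> that impose the same linear condition.\<close>

definition word_classes :: "nat \<Rightarrow> magma_word set set"
  where "word_classes n = {word_class n \<phi> r |\<phi> r. word_class n \<phi> r \<noteq> {}}"

definition coeff_sum :: "magma_word set \<Rightarrow> 'k::field free_algebra \<Rightarrow> 'k"
  where "coeff_sum A = lext (*) (\<lambda>w. if w \<in> A then 1 else 0)"

lemma linear_coeff_sum: "Vector_Spaces.linear fs_scale (*) (coeff_sum A)"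
  unfolding coeff_sum_def by (rule vector_space.linear_lext) (unfold_locales; simp add: algebra_simps)

lemma lookup_eval_poly_basis:
  fixes f :: "'k::field_char_0 free_algebra"
  assumes "f \<in> multilinear_polys n 0"
  shows "Poly_Mapping.lookup (eval_poly fs_scale mul (\<lambda>g. Poly_Mapping.single (\<phi> g) 1) f) r
    = coeff_sum (word_class n \<phi> r) f"
proof -
  have "Poly_Mapping.lookup (basis_elem (ev \<phi> w) :: 'i \<Rightarrow>\<^sub>0 'k) r
      = (if w \<in> word_class n \<phi> r then 1 else 0)" if "w \<in> Poly_Mapping.keys f" for w
    using that assms
    by (auto simp: multilinear_polys_def word_class_def basis_elem_def lookup_single when_def
        split: option.split)
  then show ?thesis
    by (simp add: eval_poly_def coeff_sum_def lext_def lookup_sum eval_word_basis)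
qed

lemma subspace_multilinear_polys:
  "module.subspace fs_scale (multilinear_polys k l :: 'k::field free_algebra set)"
proof -
  interpret fs: vector_space "fs_scale :: 'k \<Rightarrow> (magma_word \<Rightarrow>\<^sub>0 'k) \<Rightarrow> _" by (rule vector_space_fs_scale)
  show ?thesis
    using keys_add
    by (auto simp: fs.subspace_def multilinear_polys_def in_keys_iff lookup_add) 
qed

abbreviation Id_star where "Id_star \<equiv> star_identities fs_scale mul (\<lambda>a. a)"

lemma subspace_Id: "module.subspace fs_scale (Id_star :: 'k::field_char_0 free_algebra set)"
proof -
  interpret fs: vector_space "fs_scale :: 'k \<Rightarrow> (magma_word \<Rightarrow>\<^sub>0 'k) \<Rightarrow> _" by (rule vector_space_fs_scale)
  interpret fa: vector_space "fs_scale :: 'k \<Rightarrow> ('i \<Rightarrow>\<^sub>0 'k) \<Rightarrow> _" by (rule vector_space_fs_scale)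
  interpret lext: Vector_Spaces.linear fs_scale fs_scale "lext fs_scale (eval_word mul \<phi>)"
    for \<phi> :: "generator \<Rightarrow> ('i \<Rightarrow>\<^sub>0 'k)"
    by (rule fa.linear_lext)
  show ?thesis
    by (auto simp: fs.subspace_def star_identities_def eval_poly_eq_lext lext.zero lext.add lext.scale)
qed

lemma quotient_multilinear_Id:
  "quotient_by_subspace fs_scale (multilinear_polys k l :: 'k::field_char_0 free_algebra set)
    (multilinear_polys k l \<inter> Id_star)"
proof -
  interpret fs: vector_space "fs_scale :: 'k \<Rightarrow> (magma_word \<Rightarrow>\<^sub>0 'k) \<Rightarrow> _" by (rule vector_space_fs_scale)
  show ?thesis
    using subspace_multilinear_polys subspace_Id fs.subspace_inter by unfold_locales blast+
qed

text \<open>Basis substitutions suffice by multilinearity, and the empty classes left out of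
  \<open>word_classes\<close> have coefficient sum zero anyway.\<close>

lemma mem_Id_if_coeff_sums_zero:
  fixes f :: "'k::field_char_0 free_algebra"
  assumes f: "f \<in> multilinear_polys n 0" and zero: "\<And>A. A \<in> word_classes n \<Longrightarrow> coeff_sum A f = 0"
  shows "f \<in> Id_star"
proof -
  have "coeff_sum (word_class n \<phi> r) f = 0" for \<phi> r
    using zero[of "word_class n \<phi> r"]
    by (cases "word_class n \<phi> r = {}") (auto simp: word_classes_def coeff_sum_def lext_def)
  then have basis_zero: "eval_poly fs_scale mul (\<lambda>g. Poly_Mapping.single (\<phi> g) 1) f = 0" for \<phi> :: "_ \<Rightarrow> 'i"
    by (intro poly_mapping_eqI) (simp add: lookup_eval_poly_basis[OF f])
  have "eval_poly fs_scale mul \<psi> f = 0" for \<psi>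
  proof (rule eval_poly_zero_if_zero_on_basis[OF algebra_with_involution_mul])
    show "generators w = mset_set (Sym ` {..<n})" if "w \<in> Poly_Mapping.keys f" for w
      using that f by (simp add: multilinear_polys_def)
  qed (use basis_zero in simp_all)
  then show ?thesis by (simp add: star_identities_def)
qed

lemma coeff_sum_Id:
  fixes f :: "'k::field_char_0 free_algebra"
  assumes "f \<in> multilinear_polys n 0 \<inter> Id_star"
  shows "coeff_sum (word_class n \<phi> r) f = 0"
proof -
  \<comment> \<open>A basis vector is not skew, so \<open>\<phi>\<close> itself is not an admissible
    substitution. Sending all skew variables to 0 makes it admissible and does not affect
    \<open>f\<close>, which contains only symmetric ones.\<close>
  have "eval_poly fs_scale mul (case_generator (\<lambda>i. Poly_Mapping.single (\<phi> (Sym i)) 1) (\<lambda>_. 0)) f = 0"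
    using assms by (auto simp: star_identities_def symmetric_elements_def skew_elements_def)
  moreover have "eval_poly fs_scale mul (case_generator (\<lambda>i. Poly_Mapping.single (\<phi> (Sym i)) 1) (\<lambda>_. 0)) f
    = eval_poly fs_scale mul (\<lambda>g. Poly_Mapping.single (\<phi> g) 1) f"
    unfolding eval_poly_def using assms
    by (intro sum.cong refl arg_cong2[of _ _ _ _ fs_scale]
          algebra_with_involution.eval_word_cong[OF algebra_with_involution_mul])
      (auto simp: multilinear_polys_def)
  ultimately show ?thesis
    using lookup_eval_poly_basis[of f n \<phi> r] assms by simp
qed

text \<open>The coefficient sums over the word classes cut the identities out of the multilinear
  polynomials, so their number bounds the dimension of the quotient.\<close>

lemma star_codim_le:
  assumes "finite (word_classes n)"
  shows "star_codim (fs_scale :: 'k::field_char_0 \<Rightarrow> _) mul (\<lambda>a. a) n 0 \<le> card (word_classes n)"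
proof -
  interpret quotient_by_subspace fs_scale "multilinear_polys n 0 :: 'k free_algebra set"
    "multilinear_polys n 0 \<inter> Id_star"
    by (rule quotient_multilinear_Id)
  have "Q.dim \<le> card (coeff_sum ` word_classes n :: ('k free_algebra \<Rightarrow> 'k) set)"
  proof (rule dim_quotient_le)
    show "v \<in> multilinear_polys n 0 \<inter> Id_star"
      if "v \<in> multilinear_polys n 0" "\<And>g. g \<in> coeff_sum ` word_classes n \<Longrightarrow> g v = 0" for v :: "'k free_algebra"
      using that mem_Id_if_coeff_sums_zero by blast
  qed (use assms linear_coeff_sum in auto)
  also have "\<dots> \<le> card (word_classes n)"
    by (rule card_image_le[OF assms])
  finally show ?thesis by (simp add: star_codim_def free_scale_eq)
qed

text \<open>The hypothesis \<open>dual\<close> says that the monomials \<open>u j\<close> and the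
  coordinate at \<open>r i\<close> under the substitution \<open>\<phi> i\<close> form a dual
  system. These functionals vanish on identities, so the monomials stay independent in the
  quotient.\<close>

lemma star_codim_ge:
  assumes "finite (word_classes n)" "finite I"
    and gens: "\<And>i. i \<in> I \<Longrightarrow> generators (u i) = mset_set (Sym ` {..<n})"
    and dual: "\<And>i j. i \<in> I \<Longrightarrow> j \<in> I \<Longrightarrow> ev (\<phi> i) (u j) = Some (r i) \<longleftrightarrow> i = j"
  shows "card I \<le> star_codim (fs_scale :: 'k::field_char_0 \<Rightarrow> _) mul (\<lambda>a. a) n 0"
proof -
  interpret quotient_by_subspace fs_scale "multilinear_polys n 0 :: 'k free_algebra set"
    "multilinear_polys n 0 \<inter> Id_star"
    by (rule quotient_multilinear_Id)
  have "Q.fin_dim"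
  proof (rule fin_dim_quotient)
    show "v \<in> multilinear_polys n 0 \<inter> Id_star"
      if "v \<in> multilinear_polys n 0" "\<And>g. g \<in> coeff_sum ` word_classes n \<Longrightarrow> g v = 0" for v :: "'k free_algebra"
      using that mem_Id_if_coeff_sums_zero by blast
  qed (use assms(1) linear_coeff_sum in auto)
  then have "card I \<le> Q.dim"
  proof (rule dim_quotient_ge[OF _ assms(2)])
    show "Poly_Mapping.single (u i) 1 \<in> multilinear_polys n 0" if "i \<in> I" for i
      using gens[OF that] by (simp add: multilinear_polys_def)
    show "Vector_Spaces.linear fs_scale (*) (coeff_sum (word_class n (\<phi> i) (r i)))" for i
      by (rule linear_coeff_sum)
    show "coeff_sum (word_class n (\<phi> i) (r i)) v = 0" if "v \<in> multilinear_polys n 0 \<inter> Id_star" for i and v :: "'k free_algebra"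
      using that by (rule coeff_sum_Id)
    show "coeff_sum (word_class n (\<phi> i) (r i)) (Poly_Mapping.single (u j) 1) = (if i = j then 1 else 0)"
      if "i \<in> I" "j \<in> I" for i j
      using gens[OF that(2)] dual[OF that] by (simp add: coeff_sum_def lext_def word_class_def)
  qed
  then show ?thesis by (simp add: star_codim_def free_scale_eq)
qed

section \<open>Reduction to symmetric variables\<close>

lemma skew_elements_identity: "skew_elements (\<lambda>a. a) = {0 :: 'i \<Rightarrow>\<^sub>0 'k::field_char_0}"
proof -
  have "b = 0" if "b = - b" for b :: "'i \<Rightarrow>\<^sub>0 'k"
  proof (rule poly_mapping_eqI)
    fix i
    have "Poly_Mapping.lookup b i = - Poly_Mapping.lookup b i"
      using that by (metis lookup_uminus)
    then have "2 * Poly_Mapping.lookup b i = 0" by (simp add: eq_neg_iff_add_eq_0)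
    then show "Poly_Mapping.lookup b i = Poly_Mapping.lookup 0 i" by simp
  qed
  then show ?thesis by (auto simp: skew_elements_def)
qed

text \<open>Only 0 can be substituted for \<open>Skew 0\<close>, and evaluation is linear in that
  variable. Hence every multilinear polynomial with a skew variable is an identity.\<close>

lemma star_codim_skew:
  assumes "l > 0"
  shows "star_codim (fs_scale :: 'k::field_char_0 \<Rightarrow> _) mul (\<lambda>a. a) k l = 0"
proof -
  interpret quotient_by_subspace fs_scale "multilinear_polys k l :: 'k free_algebra set"
    "multilinear_polys k l \<inter> Id_star"
    by (rule quotient_multilinear_Id)
  have "eval_poly fs_scale mul \<phi> f = 0"
    if f: "f \<in> multilinear_polys k l" and \<phi>: "\<And>i. \<phi> (Skew i) = 0" for \<phi> and f :: "'k free_algebra"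
  proof -
    have "count (generators w) (Skew 0) = 1" if "w \<in> Poly_Mapping.keys f" for w
      using that f assms by (auto simp: multilinear_polys_def)
    then interpret lin: Vector_Spaces.linear fs_scale fs_scale "\<lambda>a. eval_poly fs_scale mul (\<phi>(Skew 0 := a)) f"
      by (rule algebra_with_involution.linear_eval_poly_variable[OF algebra_with_involution_mul])
    show ?thesis using lin.zero \<phi>[of 0] by (metis fun_upd_triv)
  qed
  then have "f \<in> Id_star" if "f \<in> multilinear_polys k l" for f :: "'k free_algebra"
    using that by (simp add: star_identities_def skew_elements_identity)
  then have "Q.dim \<le> card ({} :: ('k free_algebra \<Rightarrow> 'k) set)"
    by (intro dim_quotient_le) auto
  then show ?thesis by (simp add: star_codim_def free_scale_eq)
qed

lemma total_star_codim_eq: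
  "total_star_codim (fs_scale :: 'k::field_char_0 \<Rightarrow> _) mul (\<lambda>a. a) n
    = star_codim (fs_scale :: 'k \<Rightarrow> _) mul (\<lambda>a. a) n 0"
proof -
  have "total_star_codim (fs_scale :: 'k \<Rightarrow> _) mul (\<lambda>a. a) n
    = (\<Sum>k\<in>{n}. (n choose k) * star_codim (fs_scale :: 'k \<Rightarrow> _) mul (\<lambda>a. a) k (n - k))"
    unfolding total_star_codim_def by (rule sum.mono_neutral_right) (auto simp: star_codim_skew)
  then show ?thesis by simp
qed

end

section \<open>The algebra of periodic tracks\<close>

text \<open>Letters and states are coded injectively in \<open>nat\<close>, and together they
  exhaust it, so that the algebra has the basis type \<open>nat\<close> of the final
  statement.\<close>

definition letter :: "nat \<Rightarrow> nat"
  where "letter a = sum_encode (Inl a)"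

definition state :: "nat \<Rightarrow> nat \<Rightarrow> nat"
  where "state k t = sum_encode (Inr (prod_encode (k, t)))"

lemma letter_state_simps [simp]:
  "letter a = letter b \<longleftrightarrow> a = b"
  "state k t = state k' t' \<longleftrightarrow> k = k' \<and> t = t'"
  "letter a \<noteq> state k t" "state k t \<noteq> letter a"
  by (simp_all add: letter_def state_def sum_encode_eq prod_encode_eq)

lemma letter_state_cases:
  obtains a where "i = letter a" | k t where "i = state k t"
proof (cases "sum_decode i")
  case (Inl a)
  then show ?thesis using that(1) by (metis letter_def sum_decode_inverse)
next
  case (Inr p)
  then show ?thesis
    using that(2) by (metis state_def sum_decode_inverse prod_decode_inverse surj_pair)
qed

text \<open>The letter that moves a state from time \<open>t\<close> to time \<open>t + 1\<close> on a track of period \<open>m\<close>: letter \<open>0\<close>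
  at ordinary times, and a letter of its own at each time divisible by \<open>m\<close>.\<close>

definition label :: "nat \<Rightarrow> nat \<Rightarrow> nat"
  where "label m t = (if m dvd t then Suc t else 0)"

section \<open>Left normed words up to commutativity\<close>

primrec juxts :: "magma_word \<Rightarrow> nat"
  where
    "juxts (Gen g) = 0"
  | "juxts (Juxt u v) = Suc (juxts u + juxts v)"

lemma size_generators: "size (generators w) = Suc (juxts w)"
  by (induction w) auto

text \<open>\<open>accepts g0 c w\<close> says that, up to commutativity, \<open>w\<close> is a left normed product starting with
  \<open>g0\<close> whose factor number \<open>s\<close> (counted from \<open>0\<close> after \<open>g0\<close>) satisfies \<open>c s\<close>.\<close>

primrec accepts :: "generator \<Rightarrow> (nat \<Rightarrow> generator \<Rightarrow> bool) \<Rightarrow> magma_word \<Rightarrow> bool"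
  where
    "accepts g0 c (Gen g) \<longleftrightarrow> g = g0"
  | "accepts g0 c (Juxt u v) \<longleftrightarrow>
      (\<exists>g. v = Gen g \<and> accepts g0 c u \<and> c (juxts u) g) \<or>
      (\<exists>g. u = Gen g \<and> accepts g0 c v \<and> c (juxts v) g)"

lemma accepts_cong:
  assumes "\<And>s g. s < juxts w \<Longrightarrow> g \<in># generators w \<Longrightarrow> c s g = c' s g"
  shows "accepts g0 c w = accepts g0 c' w"
  using assms
proof (induction w)
  case (Juxt u v)
  have "accepts g0 c u = accepts g0 c' u" "accepts g0 c v = accepts g0 c' v"
    using Juxt.prems by (auto intro!: Juxt.IH)
  then show ?case using Juxt.prems by auto
qed simp

text \<open>Peeling single generators off the outside of the word lists its factors: the outermost
  one has position \<open>juxts u\<close>, and recording it there leaves the earlier positions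
  untouched.\<close>

lemma accepts_order:
  assumes "accepts g0 c w"
  shows "\<exists>v. (\<forall>s<juxts w. c s (v s)) \<and> generators w = add_mset g0 (image_mset v (mset_set {..<juxts w}))"
  using assms
proof (induction w)
  case (Juxt u v)
  have step: "\<exists>f. (\<forall>s<Suc (juxts u). c s (f s)) \<and>
      add_mset g (generators u) = add_mset g0 (image_mset f (mset_set {..<Suc (juxts u)}))"
    if "c (juxts u) g" and IH: "\<exists>f. (\<forall>s<juxts u. c s (f s)) \<and>
      generators u = add_mset g0 (image_mset f (mset_set {..<juxts u}))" for u g
  proof -
    from IH obtain f where f: "\<forall>s<juxts u. c s (f s)"
      "generators u = add_mset g0 (image_mset f (mset_set {..<juxts u}))" by blast
    have "image_mset (f(juxts u := g)) (mset_set {..<juxts u}) = image_mset f (mset_set {..<juxts u})"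
      by (intro image_mset_cong) auto
    then show ?thesis
      using f that(1) by (intro exI[of _ "f(juxts u := g)"]) (auto simp: lessThan_Suc less_Suc_eq)
  qed
  from Juxt.prems show ?case
  proof (elim accepts.simps(2)[THEN iffD1, THEN disjE] exE conjE)
    fix g assume "v = Gen g" "accepts g0 c u" "c (juxts u) g"
    with step[of u g] Juxt.IH(1) show ?thesis by simp
  next
    fix g assume "u = Gen g" "accepts g0 c v" "c (juxts v) g"
    with step[of v g] Juxt.IH(2) show ?thesis by simp
  qed
qed simp

primrec left_normed :: "generator \<Rightarrow> (nat \<Rightarrow> generator) \<Rightarrow> nat \<Rightarrow> magma_word"
  where
    "left_normed g0 v 0 = Gen g0"
  | "left_normed g0 v (Suc s) = Juxt (left_normed g0 v s) (Gen (v s))"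

lemma generators_left_normed:
  "generators (left_normed g0 v n) = add_mset g0 (image_mset v (mset_set {..<n}))"
  by (induction n) (auto simp: lessThan_Suc)

lemma juxts_left_normed [simp]: "juxts (left_normed g0 v n) = n"
  by (induction n) auto

text \<open>The mirrored reading of a product can succeed only when both factors are generators and
  the right one is \<open>g0\<close>. The hypothesis on \<open>v\<close> excludes this.\<close>

lemma accepts_left_normed:
  assumes "\<And>s. s < n \<Longrightarrow> v s \<noteq> g0"
  shows "accepts g0 c (left_normed g0 v n) \<longleftrightarrow> (\<forall>s<n. c s (v s))"
  using assms
proof (induction n)
  case (Suc n)
  have "\<not> (\<exists>g. left_normed g0 v n = Gen g \<and> v n = g0)"
    using Suc.prems[of n] by auto
  then show ?case using Suc by (auto simp: less_Suc_eq)
qed simp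

definition is_state :: "nat \<Rightarrow> bool"
  where "is_state i \<longleftrightarrow> (\<exists>k t. i = state k t)"

lemma is_state_simps [simp]: "is_state (state k t)" "\<not> is_state (letter a)"
  by (auto simp: is_state_def)

section \<open>Products of letters and states\<close>

locale periodic_tracks =
  fixes m L :: "nat \<Rightarrow> nat"
begin

definition advance :: "nat \<Rightarrow> nat \<Rightarrow> nat \<Rightarrow> nat option"
  where "advance k t a = (if a = label (m k) t \<and> Suc t < L k then Some (state k (Suc t)) else None)"

definition op :: "nat \<Rightarrow> nat \<Rightarrow> nat option"
  where "op i j = (case (sum_decode i, sum_decode j) of
      (Inr p, Inl a) \<Rightarrow> advance (fst (prod_decode p)) (snd (prod_decode p)) a
    | (Inl a, Inr p) \<Rightarrow> advance (fst (prod_decode p)) (snd (prod_decode p)) a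
    | _ \<Rightarrow> None)"

lemma op_simps [simp]:
  "op (letter a) (letter b) = None"
  "op (state k t) (state k' t') = None"
  "op (state k t) (letter a) = advance k t a"
  "op (letter a) (state k t) = advance k t a"
  by (simp_all add: op_def letter_def state_def)

sublocale commutative_partial_magma op
  by unfold_locales (auto simp: op_def split: sum.split)

lemma op_is_state: "op i j = Some r \<Longrightarrow> is_state r \<and> is_state i \<noteq> is_state j"
  by (cases i rule: letter_state_cases; cases j rule: letter_state_cases)
    (auto simp: advance_def split: if_splits)

lemma ev_letter_iff: "ev \<phi> w = Some (letter a) \<longleftrightarrow> (\<exists>g. w = Gen g \<and> \<phi> g = letter a)"
  by (cases w) (auto simp: bind_eq_Some_conv dest: op_is_state)

text \<open>A nonzero product combines one state with one letter and gives a state, so states are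
  neither created nor merged.\<close>

lemma ev_states:
  "ev \<phi> w = Some r \<Longrightarrow> size {#g \<in># generators w. is_state (\<phi> g)#} = (if is_state r then 1 else 0)"
proof (induction w arbitrary: r)
  case (Juxt u v)
  then obtain i j where ij: "ev \<phi> u = Some i" "ev \<phi> v = Some j" "op i j = Some r"
    by (auto simp: bind_eq_Some_conv)
  then show ?case
    using Juxt.IH(1)[OF ij(1)] Juxt.IH(2)[OF ij(2)] op_is_state[OF ij(3)] by auto
qed auto

text \<open>With \<open>g0\<close> the only possible state, every product must attach one letter to
  the part containing \<open>g0\<close>, and that letter must be the one demanded at the current
  time. The end of the track is checked only when a state advances, hence the separate case
  \<open>juxts w = 0\<close>.\<close>

lemma ev_state_iff:
  assumes "\<phi> g0 = state k t" and "\<And>g. g \<in># generators w \<Longrightarrow> g \<noteq> g0 \<Longrightarrow> \<not> is_state (\<phi> g)"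
  shows "ev \<phi> w = Some (state k' t') \<longleftrightarrow> k' = k \<and> t' = t + juxts w \<and>
    (juxts w = 0 \<or> t + juxts w < L k) \<and> accepts g0 (\<lambda>s g. \<phi> g = letter (label (m k) (t + s))) w"
  using assms(2)
proof (induction w arbitrary: k' t')
  case (Gen g)
  then show ?case using assms(1) by (cases "g = g0") (auto simp: is_state_def)
next
  case (Juxt u v)
  let ?c = "\<lambda>s g. \<phi> g = letter (label (m k) (t + s))"
  have op_iff: "op i j = Some (state k' t') \<longleftrightarrow>
      (\<exists>t1. t' = Suc t1 \<and> Suc t1 < L k' \<and>
        ((i = state k' t1 \<and> j = letter (label (m k') t1)) \<or> (j = state k' t1 \<and> i = letter (label (m k') t1))))" for i j
    by (cases i rule: letter_state_cases; cases j rule: letter_state_cases)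
      (auto simp: advance_def)
  have "ev \<phi> (Juxt u v) = Some (state k' t') \<longleftrightarrow>
      (\<exists>t1. t' = Suc t1 \<and> Suc t1 < L k' \<and>
        ((ev \<phi> u = Some (state k' t1) \<and> ev \<phi> v = Some (letter (label (m k') t1))) \<or>
         (ev \<phi> v = Some (state k' t1) \<and> ev \<phi> u = Some (letter (label (m k') t1)))))"
    by (auto simp: bind_eq_Some_conv op_iff)
  also have "\<dots> \<longleftrightarrow> k' = k \<and> t' = t + juxts (Juxt u v) \<and>
    (juxts (Juxt u v) = 0 \<or> t + juxts (Juxt u v) < L k) \<and> accepts g0 ?c (Juxt u v)"
    using Juxt.IH Juxt.prems by (auto simp: ev_letter_iff)
  finally show ?case .
qed

text \<open>The possible sets of positions, among the \<open>n - 1\<close> factors after the initial state, at which a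
  nonzero product of degree \<open>n\<close> has to use a distinguished letter.\<close>

definition patterns :: "nat \<Rightarrow> nat set set"
  where "patterns n = {{s. s < n - 1 \<and> m k dvd t + s} |k t. t + n \<le> L k}"

definition placement :: "generator \<Rightarrow> nat set \<Rightarrow> (nat \<Rightarrow> generator) \<Rightarrow> nat \<Rightarrow> generator \<Rightarrow> bool"
  where "placement g0 P h s g \<longleftrightarrow> g \<noteq> g0 \<and> (if s \<in> P then g = h s else g \<notin> h ` P)"

definition accepted :: "nat \<Rightarrow> generator \<times> nat set \<times> (nat \<Rightarrow> generator) \<Rightarrow> magma_word set"
  where "accepted n = (\<lambda>(g0, P, h).
    {w. generators w = mset_set (Sym ` {..<n}) \<and> accepts g0 (placement g0 P h) w})"

text \<open>One word \<open>w0\<close> of the class determines the class: it reveals the state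
  variable \<open>g0\<close> and an order \<open>v\<close> of the remaining variables, and only the
  restriction of \<open>v\<close> to the distinguished positions influences which other words have
  the same value.\<close>

lemma word_classes_subset:
  assumes "n \<ge> 2"
  shows "word_classes n \<subseteq>
    accepted n ` (Sym ` {..<n} \<times> (SIGMA P:patterns n. P \<rightarrow>\<^sub>E Sym ` {..<n}))"
proof
  let ?X = "Sym ` {..<n}"
  fix A assume "A \<in> word_classes n"
  then obtain \<phi> r w0 where A: "A = word_class n \<phi> r"
    and w0: "generators w0 = mset_set ?X" "ev \<phi> w0 = Some r"
    by (auto simp: word_classes_def word_class_def)
  have cardX: "card ?X = n" by (simp add: card_image inj_on_def)
  have juxts: "juxts w = n - 1" if "generators w = mset_set ?X" for w
    using size_generators[of w] that cardX by simp
  have r: "is_state r"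
  proof (rule ccontr)
    assume "\<not> is_state r"
    then obtain a where "r = letter a" by (cases r rule: letter_state_cases) auto
    then have "juxts w0 = 0" using w0(2) ev_letter_iff by auto
    then show False using juxts[OF w0(1)] assms by simp
  qed
  have "card {g \<in> ?X. is_state (\<phi> g)} = 1"
    using ev_states[OF w0(2)] r w0(1) by (simp add: filter_mset_mset_set)
  then obtain g0 where g0: "{g \<in> ?X. is_state (\<phi> g)} = {g0}"
    by (auto simp: card_1_singleton_iff)
  then have "is_state (\<phi> g0)" by blast
  then obtain k t where kt: "\<phi> g0 = state k t" by (auto simp: is_state_def)
  have g0X: "g0 \<in> ?X" and others: "g \<in> ?X \<Longrightarrow> g \<noteq> g0 \<Longrightarrow> \<not> is_state (\<phi> g)" for g
    using g0 by auto
  obtain k' t' where kt': "r = state k' t'" using r by (auto simp: is_state_def)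
  define c where "c s g \<longleftrightarrow> \<phi> g = letter (label (m k) (t + s))" for s g
  have ev_iff: "ev \<phi> w = Some r \<longleftrightarrow> k' = k \<and> t' = t + (n - 1) \<and> t + n \<le> L k \<and> accepts g0 c w"
    if "generators w = mset_set ?X" for w
    using ev_state_iff[of \<phi> g0 k t w k' t', OF kt] others that juxts[OF that] assms
    unfolding kt' c_def[symmetric] by auto
  with w0 have alive: "k' = k" "t' = t + (n - 1)" "t + n \<le> L k" and acc: "accepts g0 c w0" by auto
  from accepts_order[OF acc] obtain v where v: "\<forall>s<n - 1. c s (v s)"
    and gens: "mset_set ?X = add_mset g0 (image_mset v (mset_set {..<n - 1}))"
    unfolding w0(1)[symmetric] juxts[OF w0(1)] by blast
  have v_image: "v ` {..<n - 1} = ?X - {g0}"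
  proof -
    have "mset_set (?X - {g0}) = image_mset v (mset_set {..<n - 1})"
      using gens g0X by (simp add: mset_set_Diff)
    then have "set_mset (mset_set (?X - {g0})) = set_mset (image_mset v (mset_set {..<n - 1}))"
      by (rule arg_cong)
    then show ?thesis by simp
  qed
  have v_inj: "inj_on v {..<n - 1}"
    using v_image cardX g0X by (intro eq_card_imp_inj_on) simp_all
  define P where "P = {s. s < n - 1 \<and> m k dvd t + s}"
  define h where "h = restrict v P"
  have hP: "h ` P = v ` P" by (simp add: h_def)
  \<comment> \<open>Write \<open>g\<close> as \<open>v s'\<close>. It carries the letter demanded at
    \<open>s'\<close>, so the question is whether the labels at \<open>s\<close> and
    \<open>s'\<close> agree. Labels at distinguished times are nonzero and pairwise different, all
    others are 0.\<close>
  have c_iff: "c s g \<longleftrightarrow> placement g0 P h s g" if s: "s < n - 1" and g: "g \<in> ?X" for s g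
  proof (cases "g = g0")
    case True
    then show ?thesis using kt by (simp add: c_def placement_def)
  next
    case False
    then obtain s' where s': "s' < n - 1" "g = v s'" using v_image g by auto
    have "c s g \<longleftrightarrow> label (m k) (t + s) = label (m k) (t + s')"
      using v s' by (auto simp: c_def)
    also have "\<dots> \<longleftrightarrow> (if s \<in> P then s' = s else s' \<notin> P)"
      using s s' by (auto simp: label_def P_def)
    also have "s' = s \<longleftrightarrow> g = v s"
      using v_inj s s' by (auto simp: inj_on_def)
    also have "s' \<notin> P \<longleftrightarrow> g \<notin> v ` P"
      using v_inj s' by (auto simp: inj_on_def P_def)
    finally show ?thesis using False by (simp add: placement_def hP h_def)
  qed
  have "A = accepted n (g0, P, h)"
    unfolding A word_class_def accepted_def split
  proof (intro Collect_cong conj_cong refl)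
    fix w assume w: "generators w = mset_set ?X"
    have "accepts g0 c w = accepts g0 (placement g0 P h) w"
      using c_iff w juxts[OF w] by (intro accepts_cong) auto
    then show "ev \<phi> w = Some r \<longleftrightarrow> accepts g0 (placement g0 P h) w"
      using ev_iff[OF w] alive by simp
  qed
  moreover have "P \<in> patterns n" using alive(3) by (auto simp: patterns_def P_def)
  moreover have "h \<in> P \<rightarrow>\<^sub>E ?X"
    using v_image by (auto simp: h_def P_def)
  ultimately show "A \<in> accepted n ` (?X \<times> (SIGMA P:patterns n. P \<rightarrow>\<^sub>E ?X))"
    using g0X by blast
qed

lemma finite_patterns: "finite (patterns n)"
  by (rule finite_subset[of _ "Pow {..<n}"]) (auto simp: patterns_def)

lemma finite_pattern: "P \<in> patterns n \<Longrightarrow> finite P"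
  by (auto simp: patterns_def)

lemma
  assumes "n \<ge> 2"
  shows finite_word_classes: "finite (word_classes n)"
    and card_word_classes_le: "card (word_classes n) \<le> n * (\<Sum>P\<in>patterns n. n ^ card P)"
proof -
  let ?X = "Sym ` {..<n}"
  let ?I = "?X \<times> (SIGMA P:patterns n. P \<rightarrow>\<^sub>E ?X)"
  have cardX: "card ?X = n" by (simp add: card_image inj_on_def)
  have fin: "finite ?I"
    using finite_patterns finite_pattern by (intro finite_cartesian_product finite_SigmaI finite_PiE) auto
  then show "finite (word_classes n)"
    using word_classes_subset[OF assms] finite_surj by blast
  have "card (word_classes n) \<le> card ?I"
    using word_classes_subset[OF assms] fin surj_card_le by blast
  also have "card ?I = n * (\<Sum>P\<in>patterns n. n ^ card P)"
    using finite_patterns finite_pattern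
    by (simp add: card_cartesian_product cardX card_SigmaI finite_PiE card_funcsetE)
  finally show "card (word_classes n) \<le> n * (\<Sum>P\<in>patterns n. n ^ card P)" .
qed

text \<open>The dual system is indexed by the injections of \<open>P\<close> into the
  \<open>n - 1\<close> variables other than \<open>Sym 0\<close>, which is the state. Their number
  is the falling factorial on the left.\<close>

lemma star_codim_ge_prod:
  assumes "n \<ge> 2" and "t + n \<le> L k" and P: "P = {s. s < n - 1 \<and> m k dvd t + s}"
  shows "(\<Prod>i<card P. n - 1 - i) \<le> star_codim (fs_scale :: 'k::field_char_0 \<Rightarrow> _) mul (\<lambda>a. a) n 0"
proof -
  let ?Y = "Sym ` {1..<n}"
  define I where "I = {h \<in> P \<rightarrow>\<^sub>E ?Y. inj_on h P}"
  have finP: "finite P" and cardY: "card ?Y = n - 1"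
    by (simp_all add: P card_image inj_on_def)
  have "card I = (\<Prod>i<card P. n - 1 - i)"
    unfolding I_def using finP
    by (subst card_inj_on_subset_funcset) (simp_all only: cardY lessThan_atLeast0 diff_self_eq_0
        power_0 mult_1 subset_refl finite_imageI finite_atLeastLessThan)
  moreover have "card I \<le> star_codim (fs_scale :: 'k \<Rightarrow> _) mul (\<lambda>a. a) n 0"
  proof -
    have "\<exists>v. bij_betw v {..<n - 1} ?Y \<and> (\<forall>s\<in>P. v s = h s)" if h: "h \<in> I" for h
    proof -
      have hP: "inj_on h P" "h ` P \<subseteq> ?Y" using h by (auto simp: I_def)
      have "card ({..<n - 1} - P) = card (?Y - h ` P)"
        using hP finP cardY by (subst (1 2) card_Diff_subset) (auto simp: P card_image)
      then obtain f where f: "bij_betw f ({..<n - 1} - P) (?Y - h ` P)"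
        using finite_same_card_bij[of "{..<n - 1} - P" "?Y - h ` P"] by auto
      let ?v = "\<lambda>s. if s \<in> P then h s else f s"
      have "bij_betw ?v P (h ` P)"
        using bij_betw_cong[of P ?v h "h ` P"] hP(1) by (simp add: bij_betw_imageI)
      moreover have "bij_betw ?v ({..<n - 1} - P) (?Y - h ` P)"
        using bij_betw_cong[of "{..<n - 1} - P" ?v f "?Y - h ` P"] f by simp
      ultimately have "bij_betw ?v (P \<union> ({..<n - 1} - P)) (h ` P \<union> (?Y - h ` P))"
        by (rule bij_betw_combine) auto
      moreover have "P \<union> ({..<n - 1} - P) = {..<n - 1}" "h ` P \<union> (?Y - h ` P) = ?Y"
        using hP(2) by (auto simp: P)
      ultimately show ?thesis by (intro exI[of _ ?v]) simp
    qed
    then obtain v where v_bij: "\<And>h. h \<in> I \<Longrightarrow> bij_betw (v h) {..<n - 1} ?Y"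
      and v_h: "\<And>h s. h \<in> I \<Longrightarrow> s \<in> P \<Longrightarrow> v h s = h s"
      by metis
    define u where "u h = left_normed (Sym 0) (v h) (n - 1)" for h
    define \<phi> where "\<phi> h g = (if g = Sym 0 then state k t else
      if g \<in> h ` P then letter (Suc (t + inv_into P h g)) else letter 0)" for h g
    have v_ne: "v h s \<noteq> Sym 0" if "h \<in> I" "s < n - 1" for h s
      using bij_betw_apply[OF v_bij[OF that(1)], of s] that(2) by auto
    have gens: "generators (u h) = mset_set (Sym ` {..<n})" if "h \<in> I" for h
    proof -
      have "image_mset (v h) (mset_set {..<n - 1}) = mset_set ?Y"
        using v_bij[OF that] by (metis bij_betw_def image_mset_mset_set)
      moreover have "Sym ` {..<n} = insert (Sym 0) ?Y"
        using assms(1) by (auto simp: image_iff)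
      moreover have "Sym 0 \<notin> ?Y" by auto
      ultimately show ?thesis
        by (simp add: u_def generators_left_normed mset_set.insert)
    qed
    show ?thesis
    proof (rule star_codim_ge[OF finite_word_classes[OF assms(1)], of I u \<phi> "\<lambda>_. state k (t + (n - 1))"])
      show "finite I" using finP by (simp add: I_def finite_PiE)
      show "generators (u h) = mset_set (Sym ` {..<n})" if "h \<in> I" for h
        using that by (rule gens)
      fix h h' assume h: "h \<in> I" and h': "h' \<in> I"
      have "ev (\<phi> h) (u h') = Some (state k (t + (n - 1))) \<longleftrightarrow>
          accepts (Sym 0) (\<lambda>s g. \<phi> h g = letter (label (m k) (t + s))) (u h')"
        using assms(1,2)
        by (subst ev_state_iff[of _ "Sym 0" k t]) (auto simp: \<phi>_def u_def)
      also have "\<dots> \<longleftrightarrow> (\<forall>s<n - 1. \<phi> h (v h' s) = letter (label (m k) (t + s)))"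
        unfolding u_def using v_ne[OF h'] by (intro accepts_left_normed) auto
      also have "\<dots> \<longleftrightarrow> h = h'"
      proof
        \<comment> \<open>The distinguished letters occur on one variable each, so they force
          \<open>h'\<close> to agree with \<open>h\<close> on \<open>P\<close>; both functions are
          extensional.\<close>
        assume *: "\<forall>s<n - 1. \<phi> h (v h' s) = letter (label (m k) (t + s))"
        have "h s = h' s" if s: "s \<in> P" for s
        proof -
          have "\<phi> h (h' s) = letter (Suc (t + s))" "h' s \<noteq> Sym 0"
            using * s v_h[OF h' s] v_ne[OF h', of s] by (auto simp: P label_def)
          then have "h' s \<in> h ` P" "inv_into P h (h' s) = s"
            by (auto simp: \<phi>_def split: if_splits)
          then show ?thesis by (metis f_inv_into_f)
        qed
        then show "h = h'" using h h' unfolding I_def by (auto intro: PiE_ext)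
      next
        assume "h = h'"
        have "\<phi> h (v h s) = letter (label (m k) (t + s))" if s: "s < n - 1" for s
        proof (cases "s \<in> P")
          case True
          then show ?thesis
            using h v_h[OF h True] v_ne[OF h s] by (simp add: \<phi>_def I_def label_def P)
        next
          case False
          have "v h s \<notin> h ` P"
          proof
            assume "v h s \<in> h ` P"
            then obtain s' where s': "s' \<in> P" "v h s = v h s'" using v_h[OF h] by force
            then have "s = s'"
              using v_bij[OF h] s by (auto simp: bij_betw_def inj_on_def P)
            with s'(1) False show False by simp
          qed
          then show ?thesis using False v_ne[OF h s] s by (simp add: \<phi>_def label_def P)
        qed
        with \<open>h = h'\<close> show "\<forall>s<n - 1. \<phi> h (v h' s) = letter (label (m k) (t + s))" by simp
      qed
      finally show "ev (\<phi> h) (u h') = Some (state k (t + (n - 1))) \<longleftrightarrow> h = h'" .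
    qed
  qed
  ultimately show ?thesis by simp
qed

end

section \<open>Growth\<close>

lemma limsup_ge_along:
  fixes X :: "nat \<Rightarrow> 'a::{complete_linorder,linorder_topology}"
  assumes "filterlim r at_top sequentially" "b \<longlonglongrightarrow> a" "\<forall>\<^sub>F k in sequentially. b k \<le> X (r k)"
  shows "a \<le> limsup X"
proof -
  have "a = limsup b" using lim_imp_Limsup[OF _ assms(2)] by simp
  also have "\<dots> \<le> limsup (\<lambda>k. X (r k))" using assms(3) by (rule Limsup_mono)
  also have "\<dots> \<le> Limsup (filtermap r sequentially) X" by (rule Limsup_filtermap_ge)
  also have "\<dots> \<le> limsup X"
    unfolding Limsup_def using assms(1)
    by (intro INF_superset_mono) (auto simp: filterlim_def dest: filter_leD)
  finally show ?thesis .
qed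

lemma liminf_le_along:
  fixes X :: "nat \<Rightarrow> 'a::{complete_linorder,linorder_topology}"
  assumes "filterlim r at_top sequentially" "b \<longlonglongrightarrow> a" "\<forall>\<^sub>F k in sequentially. X (r k) \<le> b k"
  shows "liminf X \<le> a"
proof -
  have "liminf X \<le> Liminf (filtermap r sequentially) X"
    unfolding Liminf_def using assms(1)
    by (intro SUP_subset_mono) (auto simp: filterlim_def dest: filter_leD)
  also have "\<dots> \<le> liminf (\<lambda>k. X (r k))" by (rule Liminf_filtermap_le)
  also have "\<dots> \<le> liminf b" using assms(3) by (rule Liminf_mono)
  also have "\<dots> = a" using lim_imp_Liminf[OF _ assms(2)] by simp
  finally show ?thesis .
qed

text \<open>Two solutions differ by at least \<open>m\<close>, so they lie in different blocks of
  length \<open>m\<close>.\<close>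

lemma card_multiples_window_le:
  fixes m t N :: nat
  assumes "m > 0"
  shows "card {s. s < N \<and> m dvd t + s} \<le> N div m + 1"
proof -
  have "inj_on (\<lambda>s. s div m) {s. s < N \<and> m dvd t + s}"
  proof (rule linorder_inj_onI)
    fix s s' assume "s < s'" "s \<in> {s. s < N \<and> m dvd t + s}" "s' \<in> {s. s < N \<and> m dvd t + s}"
    then have "m dvd s' - s" "0 < s' - s"
      using dvd_diff_nat[of m "t + s'" "t + s"] by auto
    then have "m \<le> s' - s" by (rule dvd_imp_le)
    then have "s div m + 1 \<le> s' div m"
      using div_le_mono[of "s + m" s' m] assms \<open>s < s'\<close> by simp
    then show "s div m \<noteq> s' div m" by simp
  qed auto
  then have "card {s. s < N \<and> m dvd t + s} \<le> card {..N div m}"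
    by (rule card_inj_on_le) (auto intro: div_le_mono)
  then show ?thesis by simp
qed

text \<open>Each number below \<open>N\<close> is a multiple of \<open>m\<close> below
  \<open>N\<close> plus one of \<open>m\<close> remainders.\<close>

lemma le_card_multiples:
  fixes m N :: nat
  assumes "m > 0"
  shows "N \<le> card {s. s < N \<and> m dvd s} * m"
proof -
  let ?f = "\<lambda>s. (m * (s div m), s mod m)"
  have "inj_on ?f {..<N}"
    by (rule inj_onI) (metis div_mult_mod_eq mult.commute prod.inject)
  moreover have "?f ` {..<N} \<subseteq> {s. s < N \<and> m dvd s} \<times> {..<m}"
    using assms by (auto intro: le_less_trans[OF times_div_less_eq_dividend])
  ultimately have "card {..<N} \<le> card ({s. s < N \<and> m dvd s} \<times> {..<m})"
    by (rule card_inj_on_le) auto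
  then show ?thesis by (simp add: card_cartesian_product)
qed

text \<open>In degree \<open>n \<le> \<alpha>\<^sup>m\<close> there are about \<open>n / m\<close> distinguished positions on a track of period \<open>m\<close>,
  hence about \<open>n\<^sup>n\<^sup>/\<^sup>m \<le> \<alpha>\<^sup>n\<close> placements, with near equality at \<open>n = \<alpha>\<^sup>m\<close>. This fixes the lifetime of
  the track; the next period exceeds it, which leaves degrees of polynomial growth in between.\<close>

primrec period :: "real \<Rightarrow> nat \<Rightarrow> nat"
  where
    "period \<alpha> 0 = 1"
  | "period \<alpha> (Suc k) = period \<alpha> k + nat \<lfloor>\<alpha> ^ period \<alpha> k\<rfloor> + 2"

definition lifetime :: "real \<Rightarrow> nat \<Rightarrow> nat"
  where "lifetime \<alpha> k = nat \<lfloor>\<alpha> ^ period \<alpha> k\<rfloor>"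

lemma strict_mono_period: "strict_mono (period \<alpha>)"
  by (simp add: strict_mono_Suc_iff)

lemma period_gt: "k < period \<alpha> k"
  by (induction k) auto

lemma filterlim_period: "filterlim (period \<alpha>) at_top sequentially"
  by (rule filterlim_subseq[OF strict_mono_period])

text \<open>The recursion adds \<open>lifetime \<alpha> k + 2\<close> to the period, so the degree
  just after the end of track \<open>k\<close> does not exceed any later period.\<close>

lemma lifetime_less_period: "k < j \<Longrightarrow> lifetime \<alpha> k + 2 \<le> period \<alpha> j"
proof -
  assume "k < j"
  then have "period \<alpha> (Suc k) \<le> period \<alpha> j"
    by (subst strict_mono_less_eq[OF strict_mono_period]) simp
  then show ?thesis by (simp add: lifetime_def)
qed

context
  fixes \<alpha> :: real
  assumes \<alpha>: "\<alpha> > 1"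
begin

lemma lifetime_le: "real (lifetime \<alpha> k) \<le> \<alpha> ^ period \<alpha> k"
  using \<alpha> by (simp add: lifetime_def)

lemma lifetime_ge: "\<alpha> ^ period \<alpha> k - 1 \<le> real (lifetime \<alpha> k)"
  using real_of_int_floor_gt_diff_one[of "\<alpha> ^ period \<alpha> k"] int_nat_eq[of "\<lfloor>\<alpha> ^ period \<alpha> k\<rfloor>"] unfolding lifetime_def by simp linarith

lemma filterlim_power_period: "filterlim (\<lambda>k. \<alpha> ^ period \<alpha> k) at_top sequentially"
proof -
  have "filterlim (\<lambda>n. \<alpha> ^ n) at_infinity sequentially"
    using \<alpha> by (intro filterlim_realpow_sequentially_gt1) simp
  from filterlim_at_infinity_imp_norm_at_top[OF this]
  have "filterlim (\<lambda>n. \<alpha> ^ n) at_top sequentially"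
    using \<alpha> by (simp add: norm_power)
  then show ?thesis by (rule filterlim_compose) (rule filterlim_period)
qed

lemma filterlim_lifetime: "filterlim (lifetime \<alpha>) at_top sequentially"
proof -
  have "filterlim (\<lambda>k. - 1 + \<alpha> ^ period \<alpha> k) at_top sequentially"
    by (rule filterlim_tendsto_add_at_top[OF tendsto_const filterlim_power_period])
  then have "filterlim (\<lambda>k. real (lifetime \<alpha> k)) at_top sequentially"
    by (rule filterlim_at_top_mono) (use lifetime_ge in \<open>auto simp: algebra_simps\<close>)
  then show ?thesis
    by (subst (asm) filterlim_sequentially_iff_filterlim_real[symmetric])
qed

interpretation periodic_tracks "period \<alpha>" "lifetime \<alpha>" .

text \<open>With \<open>q\<close> full periods in the window, a surviving track gives
  \<open>n ^ q\<close> at most \<alpha> to the power \<open>period \<alpha> k * q\<close>, whose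
  exponent is at most \<open>n\<close>. The extra factor \<open>n\<close> pays for one additional
  multiple.\<close>

lemma pattern_card_power_le:
  assumes "n \<ge> 2" "P \<in> patterns n"
  shows "real (n ^ card P) \<le> real n * \<alpha> ^ n"
proof -
  obtain k t where P: "P = {s. s < n - 1 \<and> period \<alpha> k dvd t + s}" and alive: "t + n \<le> lifetime \<alpha> k"
    using assms(2) by (auto simp: patterns_def)
  define q where "q = (n - 1) div period \<alpha> k"
  have "card P \<le> q + 1"
    unfolding P q_def using period_gt[of k \<alpha>] by (intro card_multiples_window_le) auto
  then have "real (n ^ card P) \<le> real n ^ (q + 1)"
    unfolding of_nat_power using assms(1) by (intro power_increasing) auto
  also have "real n ^ q \<le> (\<alpha> ^ period \<alpha> k) ^ q"
    using lifetime_le[of k] alive by (intro power_mono) auto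
  then have "real n ^ (q + 1) \<le> real n * (\<alpha> ^ period \<alpha> k) ^ q"
    by (simp add: mult_left_mono)
  also have "(\<alpha> ^ period \<alpha> k) ^ q \<le> \<alpha> ^ n"
  proof -
    have "period \<alpha> k * q \<le> n" unfolding q_def using times_div_less_eq_dividend[of "period \<alpha> k" "n - 1"] by linarith
    then show ?thesis unfolding power_mult[symmetric] using \<alpha> by (intro power_increasing) auto
  qed
  then have "real n * (\<alpha> ^ period \<alpha> k) ^ q \<le> real n * \<alpha> ^ n"
    by (simp add: mult_left_mono)
  finally show ?thesis .
qed

lemma sparse_pattern:
  assumes "period \<alpha> k \<ge> n"
  shows "{s. s < n - 1 \<and> period \<alpha> k dvd t + s} \<in> insert {} ((\<lambda>s. {s}) ` {..<n})"
proof -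
  let ?P = "{s. s < n - 1 \<and> period \<alpha> k dvd t + s}"
  have "card ?P \<le> (n - 1) div period \<alpha> k + 1"
    using period_gt[of k \<alpha>] by (intro card_multiples_window_le) auto
  also have "(n - 1) div period \<alpha> k = 0" using assms period_gt[of k \<alpha>] by (auto simp: div_eq_0_iff)
  finally have "card ?P \<le> 1" by simp
  then have "card ?P = 0 \<or> card ?P = 1" by linarith
  then show ?thesis
  proof
    assume "card ?P = 0"
    then show ?thesis by simp
  next
    assume "card ?P = 1"
    then obtain s where s: "?P = {s}" by (rule card_1_singletonE)
    have "s \<in> ?P" unfolding s by (rule singletonI)
    then have "s \<in> {..<n}" by auto
    then show ?thesis unfolding s by blast
  qed
qed

text \<open>Periods of at least \<open>n\<close> give only the empty set and singletons. For a
  shorter period \<open>k < period \<alpha> k\<close> bounds \<open>k\<close>, and \<open>t\<close>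
  matters only modulo the period, which leaves at most \<open>n * n\<close> pairs.\<close>

lemma card_patterns_le: "card (patterns n) \<le> n * n + (n + 1)"
proof -
  let ?f = "\<lambda>(k, t). {s. s < n - 1 \<and> period \<alpha> k dvd t + s}"
  let ?A = "?f ` ({..<n} \<times> {..<n})" and ?B = "insert {} ((\<lambda>s. {s}) ` {..<n})"
  have "patterns n \<subseteq> ?A \<union> ?B"
  proof
    fix P assume "P \<in> patterns n"
    then obtain k t where P: "P = ?f (k, t)" by (auto simp: patterns_def)
    show "P \<in> ?A \<union> ?B"
    proof (cases "period \<alpha> k \<ge> n")
      case True
      then have "P \<in> ?B" unfolding P split by (rule sparse_pattern)
      then show ?thesis by (rule UnI2)
    next
      case False
      then have "k < n" "t mod period \<alpha> k < n"
        using period_gt[of k \<alpha>] mod_less_divisor[of "period \<alpha> k" t] by linarith+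
      moreover have "P = ?f (k, t mod period \<alpha> k)"
        unfolding P by (simp add: dvd_eq_mod_eq_0 mod_add_left_eq)
      ultimately have "P \<in> ?A" by (intro image_eqI[of _ _ "(k, t mod period \<alpha> k)"]) auto
      then show ?thesis by (rule UnI1)
    qed
  qed
  then have "card (patterns n) \<le> card (?A \<union> ?B)"
    by (rule card_mono[rotated]) simp
  also have "\<dots> \<le> card ?A + card ?B"
    by (rule card_Un_le)
  also have "card ?A \<le> n * n"
    using card_image_le[of "{..<n} \<times> {..<n}" ?f] by (simp add: card_cartesian_product)
  also have "card ?B \<le> n + 1"
    using card_image_le[of "{..<n}" "\<lambda>s. {s}"] by (simp add: card_insert_if)
  finally show ?thesis by simp
qed

abbreviation codim :: "'k::field_char_0 itself \<Rightarrow> nat \<Rightarrow> nat"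
  where "codim _ n \<equiv> star_codim (fs_scale :: 'k \<Rightarrow> _) mul (\<lambda>a. a) n 0"

text \<open>There are \<open>n\<close> choices of the state variable, at most
  \<open>3 * n ^ 2\<close> patterns, and at most \<open>n * \<alpha> ^ n\<close> placements for each
  pattern.\<close>

lemma codim_upper:
  assumes "n \<ge> 2"
  shows "real (codim TYPE('k::field_char_0) n) \<le> 3 * real n ^ 4 * \<alpha> ^ n"
proof -
  have "codim TYPE('k) n \<le> n * (\<Sum>P\<in>patterns n. n ^ card P)"
    using star_codim_le[OF finite_word_classes[OF assms]] card_word_classes_le[OF assms] by (rule le_trans)
  then have "real (codim TYPE('k) n) \<le> real n * (\<Sum>P\<in>patterns n. real (n ^ card P))"
    by (metis of_nat_mono of_nat_mult of_nat_sum)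
  also have "\<dots> \<le> real n * (real (card (patterns n)) * (real n * \<alpha> ^ n))"
    using pattern_card_power_le[OF assms] by (intro mult_left_mono sum_bounded_above) auto
  also have "\<dots> \<le> real n * ((3 * real n ^ 2) * (real n * \<alpha> ^ n))"
  proof -
    have "n + 1 \<le> n * n + n * n"
      using assms by (intro add_mono) auto
    then have "card (patterns n) \<le> 3 * n ^ 2"
      using card_patterns_le[of n] unfolding power2_eq_square by linarith
    then have "real (card (patterns n)) \<le> real (3 * n ^ 2)"
      by (rule of_nat_mono)
    then show ?thesis
      using \<alpha> by (intro mult_left_mono mult_right_mono) auto
  qed
  also have "\<dots> = 3 * real n ^ 4 * \<alpha> ^ n"
    by (simp add: power2_eq_square power4_eq_xxxx)
  finally show ?thesis .
qed

text \<open>Tracks up to \<open>k\<close> are too short for degree \<open>n\<close>, and all later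
  ones have period at least \<open>n\<close>. So no product has more than one distinguished
  position.\<close>

lemma codim_gap:
  assumes "n = lifetime \<alpha> k + 1" "n \<ge> 2"
  shows "real (codim TYPE('k::field_char_0) n) \<le> 2 * real n ^ 3"
proof -
  have sub: "patterns n \<subseteq> insert {} ((\<lambda>s. {s}) ` {..<n})"
  proof
    fix P assume "P \<in> patterns n"
    then obtain j t where P: "P = {s. s < n - 1 \<and> period \<alpha> j dvd t + s}" "t + n \<le> lifetime \<alpha> j"
      by (auto simp: patterns_def)
    have "k < j"
    proof (rule ccontr)
      assume "\<not> k < j"
      then have "period \<alpha> j \<le> period \<alpha> k"
        using strict_mono_less_eq[OF strict_mono_period] by simp
      then have "\<alpha> ^ period \<alpha> j \<le> \<alpha> ^ period \<alpha> k"
        using \<alpha> by (intro power_increasing) auto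
      then have "lifetime \<alpha> j \<le> lifetime \<alpha> k"
        unfolding lifetime_def by (intro nat_mono floor_mono)
      then show False using P(2) assms(1) by simp
    qed
    then have "n \<le> period \<alpha> j" using lifetime_less_period[of k j \<alpha>] assms(1) by simp
    then show "P \<in> insert {} ((\<lambda>s. {s}) ` {..<n})" unfolding P by (rule sparse_pattern)
  qed
  have "codim TYPE('k) n \<le> n * (\<Sum>P\<in>patterns n. n ^ card P)"
    using star_codim_le[OF finite_word_classes[OF assms(2)]] card_word_classes_le[OF assms(2)] by (rule le_trans)
  also have "(\<Sum>P\<in>patterns n. n ^ card P) \<le> (\<Sum>P\<in>insert {} ((\<lambda>s. {s}) ` {..<n}). n ^ card P)"
    using sub by (intro sum_mono2) auto
  also have "\<dots> = 1 + n * n"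
    by (subst sum.insert) (auto simp: sum.reindex inj_on_def)
  also have "n * (1 + n * n) \<le> 2 * n ^ 3"
  proof -
    have "1 + n * n \<le> 2 * (n * n)" using assms(2) by (simp add: Suc_le_eq)
    from mult_le_mono2[OF this, of n] show ?thesis by (simp add: power3_eq_cube algebra_simps)
  qed
  finally have "codim TYPE('k) n \<le> 2 * n ^ 3" by simp
  from of_nat_mono[OF this, where 'a = real] show ?thesis by simp
qed

text \<open>Lifetimes are unbounded, so some track admits a nonzero product of degree
  \<open>n\<close>. This keeps the \<open>n\<close>-th roots from falling below 1.\<close>

lemma codim_pos:
  assumes "n \<ge> 2"
  shows "codim TYPE('k::field_char_0) n \<ge> 1"
proof -
  have "\<forall>\<^sub>F k in sequentially. lifetime \<alpha> k \<ge> n"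
    using filterlim_lifetime by (auto simp: filterlim_at_top)
  then obtain k where k: "0 + n \<le> lifetime \<alpha> k"
    by (auto simp: eventually_sequentially)
  define P where "P = {s. s < n - 1 \<and> period \<alpha> k dvd 0 + s}"
  have "card P \<le> card {..<n - 1}" unfolding P_def by (rule card_mono) auto
  then have "(\<Prod>i<card P. n - 1 - i) \<ge> 1"
    by (intro prod_ge_1) auto
  with star_codim_ge_prod[OF assms k P_def, where 'k = 'k] show ?thesis by linarith
qed

text \<open>In degree equal to its lifetime, track \<open>k\<close> started at time 0 has at least
  \<open>(n - 1) / period \<alpha> k\<close> distinguished positions, and each contributes a factor
  of at least \<open>\<alpha> ^ period \<alpha> k / 8\<close>.\<close>

lemma codim_lower:
  assumes "n = lifetime \<alpha> k" "period \<alpha> k \<ge> 4" "\<alpha> ^ period \<alpha> k \<ge> 8"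
  shows "(\<alpha> ^ period \<alpha> k / 8) powr ((real n - 1) / real (period \<alpha> k)) \<le> real (codim TYPE('k::field_char_0) n)"
proof -
  define p where "p = period \<alpha> k"
  define P where "P = {s. s < n - 1 \<and> p dvd 0 + s}"
  define q where "q = card P"
  have n: "n \<ge> 7" "\<alpha> ^ p / 2 \<le> real n"
    using lifetime_ge[of k] assms(3) unfolding assms(1)[symmetric] p_def[symmetric] by linarith+
  have p: "p \<ge> 4" using assms(2) by (simp add: p_def)
  have "q \<le> (n - 1) div p + 1"
    unfolding q_def P_def using p by (intro card_multiples_window_le) auto
  also have "(n - 1) div p \<le> (n - 1) div 4" by (rule div_le_mono2) (use p in auto)
  finally have "q \<le> (n - 1) div 4 + 1" by simp
  then have q_le: "4 * q \<le> n + 3" using n(1) by linarith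
  have "n - 1 \<le> q * p"
    unfolding q_def P_def using le_card_multiples[of p "n - 1"] p by simp
  then have "real (n - 1) \<le> real q * real p"
    by (metis of_nat_mono of_nat_mult)
  then have q_ge: "(real n - 1) / real p \<le> real q"
    using p n(1) by (simp add: field_simps of_nat_diff)
  have base: "1 \<le> \<alpha> ^ p / 8" using assms(3) by (simp add: p_def)
  have "(\<alpha> ^ p / 8) powr ((real n - 1) / real p) \<le> (\<alpha> ^ p / 8) powr real q"
    using q_ge base by (rule powr_mono)
  also have "\<dots> = (\<alpha> ^ p / 8) ^ q"
    using base by (intro powr_realpow) linarith
  also have "\<dots> \<le> (\<Prod>i<q. real (n - 1 - i))"
  proof -
    \<comment> \<open>From \<open>4 * q \<le> n + 3\<close> every factor is at least
      \<open>n - q\<close>, hence at least \<open>n / 4\<close>, and \<open>n\<close> is at least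
      half of \<open>\<alpha> ^ p\<close>.\<close>
    have "\<alpha> ^ p / 8 \<le> real (n - 1 - i)" if "i < q" for i
      using that q_le n by linarith
    then have "(\<Prod>i<q. \<alpha> ^ p / 8) \<le> (\<Prod>i<q. real (n - 1 - i))"
      using base by (intro prod_mono) auto
    then show ?thesis by simp
  qed
  also have "\<dots> = real (\<Prod>i<q. n - 1 - i)" by simp
  also have "\<dots> \<le> real (codim TYPE('k) n)"
    unfolding q_def using n(1) assms(1)
    by (intro of_nat_mono star_codim_ge_prod[of _ 0 k]) (auto simp: P_def p_def)
  finally show ?thesis by (simp add: p_def)
qed

lemma root_poly_exp_limit:
  fixes C c :: real
  assumes "C > 0" "c > 0"
  shows "(\<lambda>n. root n (C * real n ^ d * c ^ n)) \<longlonglongrightarrow> c"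
proof -
  have "(\<lambda>n. root n C * root n (real n) ^ d * c) \<longlonglongrightarrow> 1 * 1 ^ d * c"
    using assms by (intro tendsto_intros LIMSEQ_root LIMSEQ_root_const)
  moreover have "\<forall>\<^sub>F n in sequentially. root n C * root n (real n) ^ d * c = root n (C * real n ^ d * c ^ n)"
    using eventually_gt_at_top[of 0]
    by eventually_elim (use assms in \<open>simp add: real_root_mult real_root_power real_root_power_cancel\<close>)
  ultimately show ?thesis by (auto elim: Lim_transform_eventually)
qed

lemma limsup_root_codim:
  "limsup (\<lambda>n. ereal (root n (real (codim TYPE('k::field_char_0) n)))) = ereal \<alpha>"
proof (rule antisym)
  have "\<forall>\<^sub>F n in sequentially. ereal (root n (real (codim TYPE('k) n))) \<le> ereal (root n (3 * real n ^ 4 * \<alpha> ^ n))"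
    using eventually_ge_at_top[of 2]
    by eventually_elim (use codim_upper[where 'k = 'k] in \<open>simp add: real_root_le_mono\<close>)
  then have "limsup (\<lambda>n. ereal (root n (real (codim TYPE('k) n))))
      \<le> limsup (\<lambda>n. ereal (root n (3 * real n ^ 4 * \<alpha> ^ n)))"
    by (rule Limsup_mono)
  also have "\<dots> = ereal \<alpha>"
    using \<alpha> by (intro lim_imp_Limsup tendsto_ereal root_poly_exp_limit) auto
  finally show "limsup (\<lambda>n. ereal (root n (real (codim TYPE('k) n)))) \<le> ereal \<alpha>" .
next
  \<comment> \<open>This is the \<open>n\<close>-th root of the bound in \<open>codim_lower\<close>
    for \<open>n = lifetime \<alpha> k\<close>, written as an exponential so that its limit can be
    read off.\<close>
  define b where "b k = exp ((ln \<alpha> - ln 8 / real (period \<alpha> k)) * (1 - 1 / real (lifetime \<alpha> k)))" for k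
  have "filterlim (\<lambda>k. real (period \<alpha> k)) at_top sequentially"
    "filterlim (\<lambda>k. real (lifetime \<alpha> k)) at_top sequentially"
    using filterlim_period filterlim_lifetime filterlim_real_sequentially by (auto intro: filterlim_compose)
  then have "(\<lambda>k. ln 8 / real (period \<alpha> k)) \<longlonglongrightarrow> 0" "(\<lambda>k. 1 / real (lifetime \<alpha> k)) \<longlonglongrightarrow> 0"
    by (auto intro: tendsto_divide_0[OF tendsto_const] filterlim_at_top_imp_at_infinity)
  then have "b \<longlonglongrightarrow> exp ((ln \<alpha> - 0) * (1 - 0))"
    unfolding b_def by (intro tendsto_intros)
  then have "(\<lambda>k. ereal (b k)) \<longlonglongrightarrow> ereal \<alpha>"
    using \<alpha> by simp
  then show "ereal \<alpha> \<le> limsup (\<lambda>n. ereal (root n (real (codim TYPE('k) n))))"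
  proof (rule limsup_ge_along[OF filterlim_lifetime])
    have "\<forall>\<^sub>F k in sequentially. period \<alpha> k \<ge> 4" "\<forall>\<^sub>F k in sequentially. \<alpha> ^ period \<alpha> k \<ge> 8"
      using filterlim_period filterlim_power_period by (auto simp: filterlim_at_top)
    then show "\<forall>\<^sub>F k in sequentially. ereal (b k)
        \<le> ereal (root (lifetime \<alpha> k) (real (codim TYPE('k) (lifetime \<alpha> k))))"
    proof eventually_elim
      case (elim k)
      define n p where "n = lifetime \<alpha> k" and "p = period \<alpha> k"
      have pos: "p > 0" "n > 0" "\<alpha> ^ p / 8 > 0"
        using elim lifetime_ge[of k] \<alpha> by (auto simp: n_def p_def intro!: Nat.gr0I)
      have "b k = ((\<alpha> ^ p / 8) powr ((real n - 1) / real p)) powr (1 / real n)"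
        using pos \<alpha> unfolding powr_powr
        by (simp add: b_def powr_def ln_div ln_realpow flip: n_def p_def) (simp add: field_simps)
      also have "\<dots> \<le> real (codim TYPE('k) n) powr (1 / real n)"
        using codim_lower[OF n_def elim, where 'k = 'k] by (intro powr_mono2) (auto simp: p_def)
      also have "\<dots> = root n (real (codim TYPE('k) n))"
        using pos(2) by (simp add: root_powr_inverse)
      finally show ?case by (simp add: n_def)
    qed
  qed
qed

lemma liminf_root_codim:
  "liminf (\<lambda>n. ereal (root n (real (codim TYPE('k::field_char_0) n)))) = 1"
proof (rule antisym)
  have lim: "(\<lambda>n. ereal (root n (2 * real n ^ 3))) \<longlonglongrightarrow> 1"
    using root_poly_exp_limit[of 2 1 3] by (auto simp: one_ereal_def)
  \<comment> \<open>The upper bound comes from the degrees just after the end of each track, where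
    the codimension is at most cubic.\<close>
  have r: "filterlim (\<lambda>k. lifetime \<alpha> k + 1) at_top sequentially"
    using filterlim_lifetime by (rule filterlim_at_top_mono) auto
  have "\<forall>\<^sub>F k in sequentially. lifetime \<alpha> k \<ge> 1"
    using filterlim_lifetime by (auto simp: filterlim_at_top)
  then have "\<forall>\<^sub>F k in sequentially. ereal (root (lifetime \<alpha> k + 1) (real (codim TYPE('k) (lifetime \<alpha> k + 1))))
      \<le> ereal (root (lifetime \<alpha> k + 1) (2 * real (lifetime \<alpha> k + 1) ^ 3))"
    by (rule eventually_mono) (simp only: ereal_less_eq, intro real_root_le_mono codim_gap; simp)
  then show "liminf (\<lambda>n. ereal (root n (real (codim TYPE('k) n)))) \<le> 1"
    by (rule liminf_le_along[OF r filterlim_compose[OF lim r]])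
next
  have "\<forall>\<^sub>F n in sequentially. 1 \<le> ereal (root n (real (codim TYPE('k) n)))"
    using eventually_ge_at_top[of 2]
    by eventually_elim (use codim_pos[where 'k = 'k] in \<open>simp add: one_ereal_def Suc_le_eq\<close>)
  then show "1 \<le> liminf (\<lambda>n. ereal (root n (real (codim TYPE('k) n))))"
    by (rule Liminf_bounded)
qed

end

theorem theoremC:
  fixes \<alpha> :: real
  assumes "\<alpha> > 1"
  shows "\<exists>(scale :: 'k::field_char_0 \<Rightarrow> (nat \<Rightarrow>\<^sub>0 'k) \<Rightarrow> (nat \<Rightarrow>\<^sub>0 'k)) mul star.
    algebra_with_involution scale mul star \<and>
    lower_star_exp scale mul star = 1 \<and>
    upper_star_exp scale mul star = ereal \<alpha>"
proof -
  interpret periodic_tracks "period \<alpha>" "lifetime \<alpha>" .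
  have "lower_star_exp (fs_scale :: 'k \<Rightarrow> _) mul (\<lambda>a. a) = 1"
    unfolding lower_star_exp_def total_star_codim_eq by (rule liminf_root_codim[OF assms])
  moreover have "upper_star_exp (fs_scale :: 'k \<Rightarrow> _) mul (\<lambda>a. a) = ereal \<alpha>"
    unfolding upper_star_exp_def total_star_codim_eq by (rule limsup_root_codim[OF assms])
  ultimately show ?thesis
    using algebra_with_involution_mul[where 'k = 'k] by blast
qed

end
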